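(* Let $\Gamma$ be a finite graph with vertex set $V$. Let $(W_v,P_v)_{v\in V}$ be a family of pairs where each $W_v$ is a Coxeter group and $P_v$ is a parabolic subgroup of $W_v$. For each $v\in V$ let $H_v$ be a subgroup of $W_v$. Then the graph product of pairs $\Pi_\Gamma(H_v,H_v\cap P_v)$ is a linear group.
   Context: A graph $\Gamma$ on the vertex set $V$ is an antireflexive symmetric relation on $V$. A complete subgraph is a subset $S\subset V$ whose elements are pairwise adjacent (the empty set and singletons are included). Given for each $v\in V$ a group $G_v$ with a subgroup $A_v<G_v$, put $G_S=\prod_{v\in S}G_v\times\prod_{v\in V\setminus S}A_v$ for each complete subgraph $S$. The graph product of pairs $\Pi_\Gamma(G_v,A_v)$ is the direct limit (colimit in groups) of the groups $G_S$, with the obvious inclusions, over the poset of complete subgraphs of $\Gamma$ ordered by inclusion. Coxeter groups are finitely generated and come with their canonical finite generating set (of a Coxeter system). A parabolic subgroup of a Coxeter group $W$ with canonical generating set $S$ is a subgroup generated by a subset $S'\subset S$. A group is linear if it admits a faithful finite-dimensional linear representation over some field. *)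

theory Defs
  imports Complex_Main "HOL-Algebra.Product_Groups" "HOL-Algebra.Generated_Groups" "HOL-Algebra.Ring"
begin

section \<open>Groups given by generators and relators\<close>

text \<open>The letter \<open>(x, True)\<close> stands for the generator \<open>x\<close> and \<open>(x, False)\<close> for its formal inverse.\<close>

type_synonym 'x word = "('x \<times> bool) list"

definition words :: "'x set \<Rightarrow> 'x word set" where
  "words X = lists (X \<times> UNIV)"

inductive_set word_cong :: "'x set \<Rightarrow> 'x word set \<Rightarrow> ('x word \<times> 'x word) set"
  for X R where
  refl: "u \<in> words X \<Longrightarrow> (u, u) \<in> word_cong X R"
| sym: "(u, v) \<in> word_cong X R \<Longrightarrow> (v, u) \<in> word_cong X R"
| trans: "(u, v) \<in> word_cong X R \<Longrightarrow> (v, w) \<in> word_cong X R \<Longrightarrow> (u, w) \<in> word_cong X R"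
| cancel: "u \<in> words X \<Longrightarrow> v \<in> words X \<Longrightarrow> x \<in> X \<Longrightarrow>
    (u @ [(x, b), (x, \<not> b)] @ v, u @ v) \<in> word_cong X R"
| relator: "u \<in> words X \<Longrightarrow> v \<in> words X \<Longrightarrow> r \<in> words X \<Longrightarrow> r \<in> R \<Longrightarrow>
    (u @ r @ v, u @ v) \<in> word_cong X R"

text \<open>The group \<open>\<langle>X | R\<rangle>\<close>: the free group on \<open>X\<close> modulo the normal closure of \<open>R\<close>.\<close>

definition presented_group :: "'x set \<Rightarrow> 'x word set \<Rightarrow> 'x word set monoid" where
  "presented_group X R =
    \<lparr>carrier = words X // word_cong X R,
     monoid.mult = (\<lambda>A B. \<Union>a\<in>A. \<Union>b\<in>B. word_cong X R `` {a @ b}),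
     one = word_cong X R `` {[]}\<rparr>"

definition presented_gen :: "'x set \<Rightarrow> 'x word set \<Rightarrow> 'x \<Rightarrow> 'x word set" where
  "presented_gen X R x = word_cong X R `` {[(x, True)]}"

lemma words_simps [simp]:
  "[] \<in> words X"
  "p # w \<in> words X \<longleftrightarrow> fst p \<in> X \<and> w \<in> words X"
  "u @ v \<in> words X \<longleftrightarrow> u \<in> words X \<and> v \<in> words X"
  by (cases p; auto simp: words_def)+

lemma word_cong_words: "(u, v) \<in> word_cong X R \<Longrightarrow> u \<in> words X \<and> v \<in> words X"
  by (induction rule: word_cong.induct) auto

lemma equiv_word_cong: "equiv (words X) (word_cong X R)"
proof (rule equivI)
  show "word_cong X R \<subseteq> words X \<times> words X" by (auto dest: word_cong_words)
  show "refl_on (words X) (word_cong X R)" by (simp add: refl_on_def word_cong.refl)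
  show "Relation.sym (word_cong X R)" by (rule symI) (rule word_cong.sym)
  show "Relation.trans (word_cong X R)" by (rule transI) (rule word_cong.trans)
qed

lemma word_cong_append_left:
  "(u, v) \<in> word_cong X R \<Longrightarrow> w \<in> words X \<Longrightarrow> (w @ u, w @ v) \<in> word_cong X R"
proof (induction rule: word_cong.induct)
  case (cancel u v x b)
  then show ?case using word_cong.cancel[of "w @ u" X v x b R] by simp
next
  case (relator u v r)
  then show ?case using word_cong.relator[of "w @ u" X v r R] by simp
next
  case (trans u v w')
  show ?case
    by (rule word_cong.trans[OF trans.IH(1)[OF trans.prems] trans.IH(2)[OF trans.prems]])
qed (simp_all add: word_cong.refl word_cong.sym)

lemma word_cong_append_right:
  "(u, v) \<in> word_cong X R \<Longrightarrow> w \<in> words X \<Longrightarrow> (u @ w, v @ w) \<in> word_cong X R"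
proof (induction rule: word_cong.induct)
  case (cancel u v x b)
  then show ?case using word_cong.cancel[of u X "v @ w" x b R] by simp
next
  case (relator u v r)
  then show ?case using word_cong.relator[of u X "v @ w" r R] by simp
next
  case (trans u v w')
  show ?case
    by (rule word_cong.trans[OF trans.IH(1)[OF trans.prems] trans.IH(2)[OF trans.prems]])
qed (simp_all add: word_cong.refl word_cong.sym)

lemma word_cong_append:
  assumes "(u, u') \<in> word_cong X R" "(v, v') \<in> word_cong X R"
  shows "(u @ v, u' @ v') \<in> word_cong X R"
proof (rule word_cong.trans)
  show "(u @ v, u' @ v) \<in> word_cong X R"
    using assms(1) word_cong_words[OF assms(2)] by (simp add: word_cong_append_right)
  show "(u' @ v, u' @ v') \<in> word_cong X R"
    using assms(2) word_cong_words[OF assms(1)] by (simp add: word_cong_append_left)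
qed

lemma word_cong_class_eq_iff:
  "u \<in> words X \<Longrightarrow> v \<in> words X \<Longrightarrow>
    word_cong X R `` {u} = word_cong X R `` {v} \<longleftrightarrow> (u, v) \<in> word_cong X R"
  by (rule eq_equiv_class_iff[OF equiv_word_cong])

lemma UN_UN_const:
  "(\<And>a b. a \<in> A \<Longrightarrow> b \<in> B \<Longrightarrow> f a b = C) \<Longrightarrow> x \<in> A \<Longrightarrow> y \<in> B \<Longrightarrow> (\<Union>a\<in>A. \<Union>b\<in>B. f a b) = C"
  by auto

lemma presented_group_mult:
  assumes "u \<in> words X" "v \<in> words X"
  shows "word_cong X R `` {u} \<otimes>\<^bsub>presented_group X R\<^esub> word_cong X R `` {v}
          = word_cong X R `` {u @ v}"
proof -
  have "(\<Union>a\<in>word_cong X R `` {u}. \<Union>b\<in>word_cong X R `` {v}. word_cong X R `` {a @ b})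
          = word_cong X R `` {u @ v}"
  proof (rule UN_UN_const)
    fix a b assume "a \<in> word_cong X R `` {u}" "b \<in> word_cong X R `` {v}"
    then have "(u @ v, a @ b) \<in> word_cong X R"
      by (simp add: word_cong_append)
    then show "word_cong X R `` {a @ b} = word_cong X R `` {u @ v}"
      by (rule equiv_class_eq[OF equiv_word_cong, symmetric])
  next
    show "u \<in> word_cong X R `` {u}" "v \<in> word_cong X R `` {v}"
      using assms by (simp_all add: word_cong.refl)
  qed
  then show ?thesis by (simp add: presented_group_def)
qed

lemma presented_group_carrierE:
  assumes "A \<in> carrier (presented_group X R)"
  obtains u where "u \<in> words X" "A = word_cong X R `` {u}"
  using assms by (auto simp: presented_group_def elim: quotientE)

lemma presented_group_carrierI:
  "u \<in> words X \<Longrightarrow> word_cong X R `` {u} \<in> carrier (presented_group X R)"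
  by (auto simp: presented_group_def intro: quotientI)

lemma presented_group_one: "\<one>\<^bsub>presented_group X R\<^esub> = word_cong X R `` {[]}"
  by (simp add: presented_group_def)

lemma word_cong_left_inverse:
  "u \<in> words X \<Longrightarrow> \<exists>v \<in> words X. (v @ u, []) \<in> word_cong X R"
proof (induction u)
  case Nil
  show ?case by (rule bexI[of _ "[]"]) (auto intro: word_cong.refl)
next
  case (Cons p u)
  obtain x b where p: "p = (x, b)" by force
  from Cons obtain v where v: "v \<in> words X" "(v @ u, []) \<in> word_cong X R" by auto
  have "((v @ [(x, \<not> b)]) @ p # u, v @ u) \<in> word_cong X R"
    using word_cong.cancel[of v X u x "\<not> b" R] v Cons.prems p by simp
  then have "((v @ [(x, \<not> b)]) @ p # u, []) \<in> word_cong X R"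
    using v(2) by (rule word_cong.trans)
  then show ?case
    using v Cons.prems p by (intro bexI[of _ "v @ [(x, \<not> b)]"]) auto
qed

lemma group_presented_group: "group (presented_group X R)"
proof (rule groupI)
  let ?G = "presented_group X R"
  show "A \<otimes>\<^bsub>?G\<^esub> B \<in> carrier ?G" if "A \<in> carrier ?G" "B \<in> carrier ?G" for A B
    using that
    by (elim presented_group_carrierE) (simp add: presented_group_mult presented_group_carrierI)
  show "\<one>\<^bsub>?G\<^esub> \<in> carrier ?G"
    by (simp add: presented_group_one presented_group_carrierI)
  show "A \<otimes>\<^bsub>?G\<^esub> B \<otimes>\<^bsub>?G\<^esub> C = A \<otimes>\<^bsub>?G\<^esub> (B \<otimes>\<^bsub>?G\<^esub> C)"
    if "A \<in> carrier ?G" "B \<in> carrier ?G" "C \<in> carrier ?G" for A B C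
    using that by (elim presented_group_carrierE) (simp add: presented_group_mult)
  show "\<one>\<^bsub>?G\<^esub> \<otimes>\<^bsub>?G\<^esub> A = A" if "A \<in> carrier ?G" for A
    using that
    by (elim presented_group_carrierE) (simp add: presented_group_mult presented_group_one)
  show "\<exists>B \<in> carrier ?G. B \<otimes>\<^bsub>?G\<^esub> A = \<one>\<^bsub>?G\<^esub>" if "A \<in> carrier ?G" for A
  proof -
    from that obtain u where u: "u \<in> words X" "A = word_cong X R `` {u}"
      by (elim presented_group_carrierE)
    obtain v where v: "v \<in> words X" "(v @ u, []) \<in> word_cong X R"
      using word_cong_left_inverse[OF u(1)] by blast
    then show ?thesis
      using u by (intro bexI[of _ "word_cong X R `` {v}"])
        (auto simp: presented_group_mult presented_group_one presented_group_carrierI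
              word_cong_class_eq_iff)
  qed
qed

primrec eval_word :: "('g, 'b) monoid_scheme \<Rightarrow> ('x \<Rightarrow> 'g) \<Rightarrow> 'x word \<Rightarrow> 'g" where
  "eval_word G f [] = \<one>\<^bsub>G\<^esub>"
| "eval_word G f (p # w) =
     (if snd p then f (fst p) else inv\<^bsub>G\<^esub> f (fst p)) \<otimes>\<^bsub>G\<^esub> eval_word G f w"

context group
begin

lemma eval_word_closed:
  "f \<in> X \<rightarrow> carrier G \<Longrightarrow> w \<in> words X \<Longrightarrow> eval_word G f w \<in> carrier G"
  by (induction w) (auto simp: Pi_iff)

lemma eval_word_append:
  "f \<in> X \<rightarrow> carrier G \<Longrightarrow> u \<in> words X \<Longrightarrow> v \<in> words X \<Longrightarrow>
    eval_word G f (u @ v) = eval_word G f u \<otimes> eval_word G f v"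
proof (induction u)
  case Nil
  then show ?case by (simp add: eval_word_closed)
next
  case (Cons p u)
  then have "f (fst p) \<in> carrier G" by (auto simp: Pi_iff)
  with Cons show ?case by (simp add: eval_word_closed m_assoc)
qed

lemma eval_word_cong:
  assumes f: "f \<in> X \<rightarrow> carrier G" and R: "\<And>r. r \<in> R \<Longrightarrow> r \<in> words X \<Longrightarrow> eval_word G f r = \<one>"
  shows "(u, v) \<in> word_cong X R \<Longrightarrow> eval_word G f u = eval_word G f v"
proof (induction rule: word_cong.induct)
  case (cancel u v x b)
  have "f x \<in> carrier G" using f cancel by auto
  then have "eval_word G f [(x, b), (x, \<not> b)] = \<one>" by simp
  then show ?case
    using cancel f eval_word_append[OF f, of u "[(x, b), (x, \<not> b)] @ v"]
      eval_word_append[OF f, of "[(x, b), (x, \<not> b)]" v]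
    by (simp add: eval_word_closed eval_word_append[OF f] del: eval_word.simps append.simps)
next
  case (relator u v r)
  then show ?case
    by (simp add: eval_word_append[OF f] eval_word_closed[OF f] R)
qed auto

text \<open>The universal property (existence; uniqueness is \<open>presented_group_hom_unique\<close> below).\<close>

lemma presented_group_hom_exists:
  assumes f: "f \<in> X \<rightarrow> carrier G" and R: "\<And>r. r \<in> R \<Longrightarrow> r \<in> words X \<Longrightarrow> eval_word G f r = \<one>"
  shows "\<exists>F \<in> hom (presented_group X R) G. \<forall>x\<in>X. F (presented_gen X R x) = f x"
proof -
  define F where "F A = eval_word G f (SOME u. u \<in> A)" for A
  have F: "F (word_cong X R `` {u}) = eval_word G f u" if "u \<in> words X" for u
  proof -
    have "(SOME w. w \<in> word_cong X R `` {u}) \<in> word_cong X R `` {u}"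
      by (rule someI[of _ u]) (use that in \<open>auto intro: word_cong.refl\<close>)
    then show ?thesis
      using eval_word_cong[OF f R] unfolding F_def by fastforce
  qed
  have "F \<in> hom (presented_group X R) G"
    by (rule homI; (elim presented_group_carrierE)?)
       (auto simp: F presented_group_mult eval_word_append[OF f] eval_word_closed[OF f]
             elim!: presented_group_carrierE)
  moreover have "F (presented_gen X R x) = f x" if "x \<in> X" for x
    using that f by (auto simp: presented_gen_def F Pi_iff)
  ultimately show ?thesis by blast
qed

end

lemma presented_gen_closed: "x \<in> X \<Longrightarrow> presented_gen X R x \<in> carrier (presented_group X R)"
  by (simp add: presented_gen_def presented_group_carrierI)

lemma eval_word_presented_gen:
  assumes "w \<in> words X"
  shows "eval_word (presented_group X R) (presented_gen X R) w = word_cong X R `` {w}"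
  using assms
proof (induction w)
  case Nil
  show ?case by (simp add: presented_group_one)
next
  case (Cons p w)
  obtain x b where p: "p = (x, b)" by force
  interpret P: group "presented_group X R" by (rule group_presented_group)
  have x: "x \<in> X" using Cons p by simp
  have "inv\<^bsub>presented_group X R\<^esub> presented_gen X R x = word_cong X R `` {[(x, False)]}"
  proof (rule P.inv_equality)
    show "word_cong X R `` {[(x, False)]} \<otimes>\<^bsub>presented_group X R\<^esub> presented_gen X R x
            = \<one>\<^bsub>presented_group X R\<^esub>"
      using x word_cong.cancel[of "[]" X "[]" x False R]
      by (simp add: presented_gen_def presented_group_mult presented_group_one
          word_cong_class_eq_iff)
  qed (use x in \<open>auto simp: presented_gen_def presented_group_carrierI\<close>)
  then show ?case
    using Cons p x by (cases b) (auto simp: presented_gen_def presented_group_mult)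
qed

lemma presented_group_hom_unique:
  assumes "group G" "F \<in> hom (presented_group X R) G" "F' \<in> hom (presented_group X R) G"
    and "\<And>x. x \<in> X \<Longrightarrow> F (presented_gen X R x) = F' (presented_gen X R x)"
    and "A \<in> carrier (presented_group X R)"
  shows "F A = F' A"
proof -
  interpret F: group_hom "presented_group X R" G F
    using assms by (simp add: group_hom_def group_hom_axioms_def group_presented_group)
  interpret F': group_hom "presented_group X R" G F'
    using assms by (simp add: group_hom_def group_hom_axioms_def group_presented_group)
  have "F (eval_word (presented_group X R) (presented_gen X R) w)
        = F' (eval_word (presented_group X R) (presented_gen X R) w)" if "w \<in> words X" for w
    using that
  proof (induction w)
    case (Cons p w)
    then have "eval_word (presented_group X R) (presented_gen X R) w
                 \<in> carrier (presented_group X R)"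
      by (simp add: eval_word_presented_gen presented_group_carrierI)
    with Cons show ?case
      by (simp add: assms(4) presented_gen_closed)
  qed simp
  then show ?thesis
    using assms(5) by (metis eval_word_presented_gen presented_group_carrierE)
qed


section \<open>Coxeter groups and parabolic subgroups\<close>

text \<open>The value \<open>m s t = 0\<close> encodes \<open>m(s, t) = \<infinity>\<close>; the corresponding relator \<open>(st)\<^sup>0\<close> is trivial.\<close>

definition coxeter_matrix :: "'a set \<Rightarrow> ('a \<Rightarrow> 'a \<Rightarrow> nat) \<Rightarrow> bool" where
  "coxeter_matrix S m \<longleftrightarrow>
    (\<forall>s\<in>S. m s s = 1) \<and>
    (\<forall>s\<in>S. \<forall>t\<in>S. m s t = m t s) \<and>
    (\<forall>s\<in>S. \<forall>t\<in>S. s \<noteq> t \<longrightarrow> m s t \<noteq> 1)"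

definition coxeter_relators :: "'a set \<Rightarrow> ('a \<Rightarrow> 'a \<Rightarrow> nat) \<Rightarrow> 'a word set" where
  "coxeter_relators S m =
    {concat (replicate (m s t) [(s, True), (t, True)]) | s t. s \<in> S \<and> t \<in> S}"

definition coxeter_system :: "('a, 'b) monoid_scheme \<Rightarrow> 'a set \<Rightarrow> bool" where
  "coxeter_system W S \<longleftrightarrow>
    group W \<and> finite S \<and> S \<subseteq> carrier W \<and>
    (\<exists>m. coxeter_matrix S m \<and>
      (\<exists>h \<in> iso (presented_group S (coxeter_relators S m)) W.
        \<forall>s\<in>S. h (presented_gen S (coxeter_relators S m) s) = s))"

definition parabolic_subgroup :: "('a, 'b) monoid_scheme \<Rightarrow> 'a set \<Rightarrow> 'a set \<Rightarrow> bool" where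
  "parabolic_subgroup W S P \<longleftrightarrow> (\<exists>S' \<subseteq> S. P = generate W S')"


section \<open>Colimits of groups over a poset\<close>

text \<open>
  \<open>\<phi> i j : G i \<rightarrow> G j\<close>, for \<open>i \<preceq> j\<close>, are the structure maps. The generators are all the elements
  of the groups \<open>G i\<close>; the relators are the multiplication tables and the identification of
  \<open>g \<in> G i\<close> with its image \<open>\<phi> i j g\<close>.
\<close>

definition colimit_gens :: "'i set \<Rightarrow> ('i \<Rightarrow> ('g, 'b) monoid_scheme) \<Rightarrow> ('i \<times> 'g) set" where
  "colimit_gens I G = (SIGMA i:I. carrier (G i))"

definition colimit_relators ::
  "'i set \<Rightarrow> ('i \<Rightarrow> 'i \<Rightarrow> bool) \<Rightarrow> ('i \<Rightarrow> ('g, 'b) monoid_scheme) \<Rightarrow> ('i \<Rightarrow> 'i \<Rightarrow> 'g \<Rightarrow> 'g) \<Rightarrow>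
    ('i \<times> 'g) word set" where
  "colimit_relators I leq G \<phi> =
    {[((i, g), True), ((i, h), True), ((i, g \<otimes>\<^bsub>G i\<^esub> h), False)] | i g h.
       i \<in> I \<and> g \<in> carrier (G i) \<and> h \<in> carrier (G i)} \<union>
    {[((i, g), True), ((j, \<phi> i j g), False)] | i j g.
       i \<in> I \<and> j \<in> I \<and> leq i j \<and> g \<in> carrier (G i)}"

definition group_colimit ::
  "'i set \<Rightarrow> ('i \<Rightarrow> 'i \<Rightarrow> bool) \<Rightarrow> ('i \<Rightarrow> ('g, 'b) monoid_scheme) \<Rightarrow> ('i \<Rightarrow> 'i \<Rightarrow> 'g \<Rightarrow> 'g) \<Rightarrow>
    ('i \<times> 'g) word set monoid" where
  "group_colimit I leq G \<phi> = presented_group (colimit_gens I G) (colimit_relators I leq G \<phi>)"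

definition colimit_map ::
  "'i set \<Rightarrow> ('i \<Rightarrow> 'i \<Rightarrow> bool) \<Rightarrow> ('i \<Rightarrow> ('g, 'b) monoid_scheme) \<Rightarrow> ('i \<Rightarrow> 'i \<Rightarrow> 'g \<Rightarrow> 'g) \<Rightarrow>
    'i \<Rightarrow> 'g \<Rightarrow> ('i \<times> 'g) word set" where
  "colimit_map I leq G \<phi> i g =
    presented_gen (colimit_gens I G) (colimit_relators I leq G \<phi>) (i, g)"

lemma group_group_colimit: "group (group_colimit I leq G \<phi>)"
  by (simp add: group_colimit_def group_presented_group)

lemma presented_group_relator:
  assumes "r \<in> R" "r \<in> words X"
  shows "eval_word (presented_group X R) (presented_gen X R) r = \<one>\<^bsub>presented_group X R\<^esub>"
  using assms word_cong.relator[of "[]" X "[]" r R]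
  by (simp add: eval_word_presented_gen presented_group_one word_cong_class_eq_iff)

lemma colimit_map_hom:
  assumes i: "i \<in> I" and G: "group (G i)"
  shows "colimit_map I leq G \<phi> i \<in> hom (G i) (group_colimit I leq G \<phi>)"
proof -
  interpret P: group "group_colimit I leq G \<phi>" by (rule group_group_colimit)
  interpret Gi: group "G i" by (rule G)
  let ?X = "colimit_gens I G" and ?R = "colimit_relators I leq G \<phi>"
  have cl: "colimit_map I leq G \<phi> i g \<in> carrier (group_colimit I leq G \<phi>)"
    if "g \<in> carrier (G i)" for g
    using that i
    by (auto simp: colimit_map_def group_colimit_def colimit_gens_def intro!: presented_gen_closed)
  show ?thesis
  proof (rule homI)
    fix g h assume g: "g \<in> carrier (G i)" and h: "h \<in> carrier (G i)"
    have "eval_word (presented_group ?X ?R) (presented_gen ?X ?R)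
        [((i, g), True), ((i, h), True), ((i, g \<otimes>\<^bsub>G i\<^esub> h), False)] = \<one>\<^bsub>presented_group ?X ?R\<^esub>"
      by (rule presented_group_relator)
         (use i g h in \<open>auto simp: colimit_relators_def colimit_gens_def\<close>)
    then have "colimit_map I leq G \<phi> i g \<otimes>\<^bsub>group_colimit I leq G \<phi>\<^esub>
        (colimit_map I leq G \<phi> i h \<otimes>\<^bsub>group_colimit I leq G \<phi>\<^esub>
         inv\<^bsub>group_colimit I leq G \<phi>\<^esub> colimit_map I leq G \<phi> i (g \<otimes>\<^bsub>G i\<^esub> h))
        = \<one>\<^bsub>group_colimit I leq G \<phi>\<^esub>"
      using cl[of "g \<otimes>\<^bsub>G i\<^esub> h"] g h by (simp add: colimit_map_def group_colimit_def[symmetric])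
    then show "colimit_map I leq G \<phi> i (g \<otimes>\<^bsub>G i\<^esub> h) =
        colimit_map I leq G \<phi> i g \<otimes>\<^bsub>group_colimit I leq G \<phi>\<^esub> colimit_map I leq G \<phi> i h"
      using cl g h
      by (metis Gi.m_closed P.inv_closed P.inv_equality P.inv_inv P.m_assoc P.m_closed)
  qed (rule cl)
qed

lemma colimit_map_compat:
  assumes "i \<in> I" "j \<in> I" "leq i j" "\<phi> i j \<in> carrier (G i) \<rightarrow> carrier (G j)" "g \<in> carrier (G i)"
  shows "colimit_map I leq G \<phi> j (\<phi> i j g) = colimit_map I leq G \<phi> i g"
proof -
  interpret P: group "group_colimit I leq G \<phi>" by (rule group_group_colimit)
  let ?X = "colimit_gens I G" and ?R = "colimit_relators I leq G \<phi>"
  have j: "\<phi> i j g \<in> carrier (G j)" using assms by auto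
  have cl: "colimit_map I leq G \<phi> k h \<in> carrier (group_colimit I leq G \<phi>)"
    if "k \<in> I" "h \<in> carrier (G k)" for k h
    using that
    by (auto simp: colimit_map_def group_colimit_def colimit_gens_def intro!: presented_gen_closed)
  have "eval_word (presented_group ?X ?R) (presented_gen ?X ?R)
      [((i, g), True), ((j, \<phi> i j g), False)] = \<one>\<^bsub>presented_group ?X ?R\<^esub>"
    by (rule presented_group_relator)
       (use assms j in \<open>auto simp: colimit_relators_def colimit_gens_def\<close>)
  then have "colimit_map I leq G \<phi> i g \<otimes>\<^bsub>group_colimit I leq G \<phi>\<^esub>
      inv\<^bsub>group_colimit I leq G \<phi>\<^esub> colimit_map I leq G \<phi> j (\<phi> i j g) = \<one>\<^bsub>group_colimit I leq G \<phi>\<^esub>"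
    using cl[OF assms(2) j] by (simp add: colimit_map_def group_colimit_def[symmetric])
  then show ?thesis
    using cl assms j by (metis P.inv_closed P.inv_equality P.inv_inv)
qed

text \<open>Universal property of the colimit.\<close>

lemma group_colimit_universal:
  assumes K: "group K" and G: "\<And>i. i \<in> I \<Longrightarrow> group (G i)"
    and f: "\<And>i. i \<in> I \<Longrightarrow> f i \<in> hom (G i) K"
    and compat: "\<And>i j g. i \<in> I \<Longrightarrow> j \<in> I \<Longrightarrow> leq i j \<Longrightarrow> g \<in> carrier (G i) \<Longrightarrow> f j (\<phi> i j g) = f i g"
  shows "\<exists>F \<in> hom (group_colimit I leq G \<phi>) K.
      (\<forall>i\<in>I. \<forall>g\<in>carrier (G i). F (colimit_map I leq G \<phi> i g) = f i g) \<and>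
      (\<forall>F' \<in> hom (group_colimit I leq G \<phi>) K.
        (\<forall>i\<in>I. \<forall>g\<in>carrier (G i). F' (colimit_map I leq G \<phi> i g) = f i g) \<longrightarrow>
        (\<forall>A \<in> carrier (group_colimit I leq G \<phi>). F' A = F A))"
proof -
  interpret K: group K by (rule K)
  let ?X = "colimit_gens I G" and ?R = "colimit_relators I leq G \<phi>"
  define f' where "f' = (\<lambda>(i, g). f i g)"
  have cl: "f i g \<in> carrier K" if "i \<in> I" "g \<in> carrier (G i)" for i g
    using f[OF that(1)] that(2) by (auto simp: hom_def)
  have "\<exists>F \<in> hom (presented_group ?X ?R) K. \<forall>x\<in>?X. F (presented_gen ?X ?R x) = f' x"
  proof (rule K.presented_group_hom_exists)
    show "f' \<in> ?X \<rightarrow> carrier K" by (auto simp: f'_def colimit_gens_def cl)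
    fix r assume r: "r \<in> ?R" "r \<in> words ?X"
    from r(1) consider
      (mult) i g h where "r = [((i, g), True), ((i, h), True), ((i, g \<otimes>\<^bsub>G i\<^esub> h), False)]"
        "i \<in> I" "g \<in> carrier (G i)" "h \<in> carrier (G i)"
    | (ident) i j g where "r = [((i, g), True), ((j, \<phi> i j g), False)]"
        "i \<in> I" "j \<in> I" "leq i j" "g \<in> carrier (G i)"
      unfolding colimit_relators_def by blast
    then show "eval_word K f' r = \<one>\<^bsub>K\<^esub>"
    proof cases
      case mult
      have "f i (g \<otimes>\<^bsub>G i\<^esub> h) = f i g \<otimes>\<^bsub>K\<^esub> f i h"
        using f[OF mult(2)] mult by (simp add: hom_mult)
      then show ?thesis
        using mult cl by (simp add: f'_def K.m_assoc[symmetric])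
    next
      case ident
      then show ?thesis using cl compat by (simp add: f'_def)
    qed
  qed
  then obtain F where F: "F \<in> hom (group_colimit I leq G \<phi>) K"
      "\<And>i g. i \<in> I \<Longrightarrow> g \<in> carrier (G i) \<Longrightarrow> F (colimit_map I leq G \<phi> i g) = f i g"
    by (fastforce simp: group_colimit_def colimit_map_def f'_def colimit_gens_def)
  have "F' A = F A" if F': "F' \<in> hom (group_colimit I leq G \<phi>) K"
      "\<forall>i\<in>I. \<forall>g\<in>carrier (G i). F' (colimit_map I leq G \<phi> i g) = f i g"
      and A: "A \<in> carrier (group_colimit I leq G \<phi>)" for F' A
  proof (rule presented_group_hom_unique[OF K])
    show "F' \<in> hom (presented_group ?X ?R) K" "F \<in> hom (presented_group ?X ?R) K"
        "A \<in> carrier (presented_group ?X ?R)"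
      using F' F A by (simp_all add: group_colimit_def)
    show "F' (presented_gen ?X ?R x) = F (presented_gen ?X ?R x)" if "x \<in> ?X" for x
      using that F(2) F'(2) by (auto simp: colimit_gens_def colimit_map_def)
  qed
  with F show ?thesis by blast
qed


section \<open>Graph products of pairs\<close>

definition simple_graph_on :: "'v set \<Rightarrow> ('v \<times> 'v) set \<Rightarrow> bool" where
  "simple_graph_on V E \<longleftrightarrow> E \<subseteq> V \<times> V \<and> irrefl E \<and> sym E"

definition complete_subgraphs :: "'v set \<Rightarrow> ('v \<times> 'v) set \<Rightarrow> 'v set set" where
  "complete_subgraphs V E = {S. S \<subseteq> V \<and> (\<forall>x\<in>S. \<forall>y\<in>S. x \<noteq> y \<longrightarrow> (x, y) \<in> E)}"

definition pair_product ::
  "'v set \<Rightarrow> ('v \<Rightarrow> 'a monoid) \<Rightarrow> ('v \<Rightarrow> 'a set) \<Rightarrow> 'v set \<Rightarrow> ('v \<Rightarrow> 'a) monoid" where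
  "pair_product V G A S = product_group V (\<lambda>v. if v \<in> S then G v else (G v)\<lparr>carrier := A v\<rparr>)"

text \<open>
  All the groups \<open>pair_product V G A S\<close> have their carriers inside the product of the \<open>G v\<close>, so the
  inclusions between them are given by the identity function.
\<close>

definition graph_product_of_pairs ::
  "'v set \<Rightarrow> ('v \<times> 'v) set \<Rightarrow> ('v \<Rightarrow> 'a monoid) \<Rightarrow> ('v \<Rightarrow> 'a set) \<Rightarrow>
    ('v set \<times> ('v \<Rightarrow> 'a)) word set monoid" where
  "graph_product_of_pairs V E G A =
    group_colimit (complete_subgraphs V E) (\<subseteq>) (pair_product V G A) (\<lambda>S T g. g)"


section \<open>Linear groups\<close>

definition matrix_monoid :: "('k, 'b) ring_scheme \<Rightarrow> nat \<Rightarrow> (nat \<times> nat \<Rightarrow> 'k) monoid" where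
  "matrix_monoid K n =
    \<lparr>carrier = ({..<n} \<times> {..<n}) \<rightarrow>\<^sub>E carrier K,
     monoid.mult = (\<lambda>A B. \<lambda>(i, j)\<in>{..<n} \<times> {..<n}. \<Oplus>\<^bsub>K\<^esub>k\<in>{..<n}. A (i, k) \<otimes>\<^bsub>K\<^esub> B (k, j)),
     one = (\<lambda>(i, j)\<in>{..<n} \<times> {..<n}. if i = j then \<one>\<^bsub>K\<^esub> else \<zero>\<^bsub>K\<^esub>)\<rparr>"

definition general_linear_group :: "('k, 'b) ring_scheme \<Rightarrow> nat \<Rightarrow> (nat \<times> nat \<Rightarrow> 'k) monoid" where
  "general_linear_group K n = units_of (matrix_monoid K n)"

text \<open>
  One cannot quantify existentially over the type of the field elements, so the field is taken with
  carrier in the type \<open>'g + real\<close>. This loses no generality: the entries of the matrices of a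
  faithful representation over any field generate a subfield that is countable or of cardinality at
  most that of \<open>G\<close>, hence isomorphic to a field with carrier in \<open>'g + real\<close>.
\<close>

definition linear_group :: "('g, 'b) monoid_scheme \<Rightarrow> bool" where
  "linear_group G \<longleftrightarrow>
    (\<exists>(K :: ('g + real) ring) n. field K \<and>
      (\<exists>\<rho> \<in> hom G (general_linear_group K n). inj_on \<rho> (carrier G)))"

end

theory Submission
  imports Defs "HOL-Algebra.Bij"
begin

text \<open>
  Write \<open>P v\<close> as the subgroup generated by \<open>T v \<subseteq> S v\<close>. The graph product of the pairs
  \<open>(W v, P v)\<close> is then itself a Coxeter group: its generators are the pairs \<open>(v, s)\<close> with \<open>s \<in> S v\<close>;
  generators over the same vertex keep their relation, and generators over different vertices \<open>v\<close>,
  \<open>w\<close> commute if \<open>v\<close> and \<open>w\<close> are adjacent or if one of the two lies in its \<open>T\<close>, and are unrelated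
  otherwise (\<open>pair_matrix\<close>). Call \<open>C\<close> the Coxeter group with this matrix. The proof embeds the graph
  product \<open>GP\<close> of the pairs \<open>(H v, H v \<inter> P v)\<close> into \<open>C\<close>, and \<open>C\<close> into a general linear group.

  Linearity of \<open>C\<close> is Tits' theorem that the reflection representation is faithful. The key is
  \<open>root_nonneg\<close>: if right multiplication by \<open>s\<close> does not shorten \<open>g\<close>, then \<open>g\<close> maps the basis vector
  of \<open>s\<close> to a vector with nonnegative coordinates. If \<open>g \<noteq> 1\<close> ends in \<open>s\<close> in a reduced word, then
  \<open>g = g' s\<close> with \<open>g'\<close> of this kind, so \<open>g\<close> maps that basis vector to a nonpositive vector and is not
  the identity.

  For the embedding, the maps \<open>H v \<rightarrow> W v \<rightarrow> C\<close> induce \<open>\<Phi> : GP \<rightarrow> C\<close>. To see that \<open>\<Phi>\<close> is injective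
  it is enough to let \<open>C\<close> act on a set in such a way that \<open>\<gamma> \<in> GP\<close> can be recovered from the action of
  \<open>\<Phi> \<gamma>\<close>. The set is \<open>\<Omega> = (\<Prod>v. W v) \<times> GP\<close>. Choose maps \<open>\<sigma> v : W v \<rightarrow> H v\<close> that are constant on the cosets
  \<open>P v x\<close> and pick a representative in \<open>H v\<close> from each coset that meets \<open>H v\<close>. An element \<open>k\<close> of
  \<open>W v\<close> sends \<open>(g, a)\<close> to the pair in which \<open>g v\<close> is replaced by \<open>k g v\<close> and \<open>a\<close> is multiplied on the left
  by the image of \<open>\<sigma> (k g v) \<sigma> (g v)\<^sup>-\<^sup>1 \<in> H v\<close>. This telescopes, so it is an action of \<open>W v\<close>;
  elements of \<open>P v\<close> do not change \<open>a\<close>, and this makes all the commutation relations of \<open>C\<close> hold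
  (\<open>act_commute\<close>). On the part of \<open>\<Omega>\<close> with \<open>g v \<in> H v\<close> for all \<open>v\<close>, the element
  \<open>g \<sigma>(g)\<^sup>-\<^sup>1 a\<close> of \<open>GP\<close> (whose first factor has coordinates in \<open>H v \<inter> P v\<close>) is multiplied by
  \<open>\<gamma>\<close> when \<open>\<Phi> \<gamma>\<close> acts (\<open>val_act\<close>), so \<open>\<Phi> \<gamma> = 1\<close> forces \<open>\<gamma> = 1\<close>.
\<close>

section \<open>Groups of bijections, products and generators\<close>

lemma carrier_BijGroup_UNIV: "carrier (BijGroup UNIV) = {f. bij f}"
  by (auto simp: BijGroup_def Bij_def)

lemma mult_BijGroup_UNIV: "bij f \<Longrightarrow> bij g \<Longrightarrow> f \<otimes>\<^bsub>BijGroup UNIV\<^esub> g = f \<circ> g"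
  by (auto simp: BijGroup_def Bij_def compose_def)

lemma one_BijGroup_UNIV: "\<one>\<^bsub>BijGroup UNIV\<^esub> = id"
  by (auto simp: BijGroup_def)

lemma mult_BijGroup_apply:
  "f \<in> carrier (BijGroup A) \<Longrightarrow> h \<in> carrier (BijGroup A) \<Longrightarrow> x \<in> A \<Longrightarrow> (f \<otimes>\<^bsub>BijGroup A\<^esub> h) x = f (h x)"
  by (simp add: BijGroup_def compose_def)

lemma BijGroup_eqI:
  "f \<in> carrier (BijGroup A) \<Longrightarrow> h \<in> carrier (BijGroup A) \<Longrightarrow> (\<And>x. x \<in> A \<Longrightarrow> f x = h x) \<Longrightarrow> f = h"
  by (auto simp: BijGroup_def Bij_def intro: extensionalityI)

lemma (in group) foldr_mult_closed:
  "(\<And>v. v \<in> set vs \<Longrightarrow> x v \<in> carrier G) \<Longrightarrow> foldr (\<lambda>v a. x v \<otimes> a) vs \<one> \<in> carrier G"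
  by (induction vs) auto

lemma (in group) foldr_mult_commute:
  assumes c: "c \<in> carrier G" and "\<And>v. v \<in> set vs \<Longrightarrow> x v \<in> carrier G"
    and "\<And>v. v \<in> set vs \<Longrightarrow> c \<otimes> x v = x v \<otimes> c"
  shows "c \<otimes> foldr (\<lambda>v a. x v \<otimes> a) vs \<one> = foldr (\<lambda>v a. x v \<otimes> a) vs \<one> \<otimes> c"
  using assms(2,3)
proof (induction vs)
  case Nil
  show ?case using c by simp
next
  case (Cons w ws)
  let ?Z = "foldr (\<lambda>v a. x v \<otimes> a) ws \<one>"
  have Z: "?Z \<in> carrier G" by (rule foldr_mult_closed) (use Cons.prems in auto)
  have w: "x w \<in> carrier G" "c \<otimes> x w = x w \<otimes> c" using Cons.prems by auto
  have "c \<otimes> (x w \<otimes> ?Z) = x w \<otimes> (c \<otimes> ?Z)"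
    using w Z c by (simp add: m_assoc[symmetric])
  then show ?case using Cons w Z c by (simp add: m_assoc)
qed

lemma (in group) foldr_mult_distrib:
  assumes "distinct vs" "\<And>v. v \<in> set vs \<Longrightarrow> x v \<in> carrier G" "\<And>v. v \<in> set vs \<Longrightarrow> y v \<in> carrier G"
    and "\<And>v w. v \<in> set vs \<Longrightarrow> w \<in> set vs \<Longrightarrow> v \<noteq> w \<Longrightarrow> y v \<otimes> x w = x w \<otimes> y v"
  shows "foldr (\<lambda>v a. (x v \<otimes> y v) \<otimes> a) vs \<one>
    = foldr (\<lambda>v a. x v \<otimes> a) vs \<one> \<otimes> foldr (\<lambda>v a. y v \<otimes> a) vs \<one>"
  using assms
proof (induction vs)
  case (Cons u us)
  let ?X = "foldr (\<lambda>v a. x v \<otimes> a) us \<one>" and ?Y = "foldr (\<lambda>v a. y v \<otimes> a) us \<one>"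
  have X: "?X \<in> carrier G" and Y: "?Y \<in> carrier G"
    by (rule foldr_mult_closed; use Cons.prems in auto)+
  have u: "x u \<in> carrier G" "y u \<in> carrier G" using Cons.prems by auto
  have "y u \<otimes> ?X = ?X \<otimes> y u"
    by (rule foldr_mult_commute) (use Cons.prems in auto)
  then have "x u \<otimes> (y u \<otimes> (?X \<otimes> ?Y)) = x u \<otimes> (?X \<otimes> (y u \<otimes> ?Y))"
    using X Y u by (simp add: m_assoc[symmetric])
  then show ?case using Cons X Y u by (simp add: m_assoc)
qed simp

lemma hom_eq_on_generate:
  assumes G: "group G" and K: "group K" and F: "F \<in> hom G K" and F': "F' \<in> hom G K"
    and "S \<subseteq> carrier G" and "\<And>s. s \<in> S \<Longrightarrow> F s = F' s" and "x \<in> generate G S"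
  shows "F x = F' x"
proof -
  interpret G: group G by (rule G)
  interpret F: group_hom G K F using G K F by (simp add: group_hom_def group_hom_axioms_def)
  interpret F': group_hom G K F' using G K F' by (simp add: group_hom_def group_hom_axioms_def)
  show ?thesis
    using assms(7)
  proof (induction rule: generate.induct)
    case (eng x y)
    then show ?case using G.generate_in_carrier[OF assms(5)] by simp
  next
    case (inv x)
    then show ?case using assms(5,6) by (simp add: subset_iff)
  qed (use assms(6) in auto)
qed

text \<open>
  Conjugation by \<open>c\<close> turns \<open>F\<close> into a second homomorphism, which agrees with \<open>F\<close> on the generators.
\<close>

lemma commute_on_generate:
  assumes G: "group G" and K: "group K" and F: "F \<in> hom G K" and c: "c \<in> carrier K"
    and S: "S \<subseteq> carrier G" and comm: "\<And>s. s \<in> S \<Longrightarrow> c \<otimes>\<^bsub>K\<^esub> F s = F s \<otimes>\<^bsub>K\<^esub> c" and "x \<in> generate G S"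
  shows "c \<otimes>\<^bsub>K\<^esub> F x = F x \<otimes>\<^bsub>K\<^esub> c"
proof -
  interpret K: group K by (rule K)
  have conj_hom: "(\<lambda>x. c \<otimes>\<^bsub>K\<^esub> F x \<otimes>\<^bsub>K\<^esub> inv\<^bsub>K\<^esub> c) \<in> hom G K"
  proof (rule homI)
    have cancel: "inv\<^bsub>K\<^esub> c \<otimes>\<^bsub>K\<^esub> (c \<otimes>\<^bsub>K\<^esub> z) = z" if "z \<in> carrier K" for z
      using c that by (simp add: K.m_assoc[symmetric])
    fix x y assume "x \<in> carrier G" "y \<in> carrier G"
    then show "c \<otimes>\<^bsub>K\<^esub> F (x \<otimes>\<^bsub>G\<^esub> y) \<otimes>\<^bsub>K\<^esub> inv\<^bsub>K\<^esub> c
        = c \<otimes>\<^bsub>K\<^esub> F x \<otimes>\<^bsub>K\<^esub> inv\<^bsub>K\<^esub> c \<otimes>\<^bsub>K\<^esub> (c \<otimes>\<^bsub>K\<^esub> F y \<otimes>\<^bsub>K\<^esub> inv\<^bsub>K\<^esub> c)"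
      using c hom_in_carrier[OF F] by (simp add: hom_mult[OF F] K.m_assoc cancel)
  qed (use c hom_in_carrier[OF F] in simp)
  have conj_eq: "c \<otimes>\<^bsub>K\<^esub> y \<otimes>\<^bsub>K\<^esub> inv\<^bsub>K\<^esub> c = y \<longleftrightarrow> c \<otimes>\<^bsub>K\<^esub> y = y \<otimes>\<^bsub>K\<^esub> c" if "y \<in> carrier K" for y
    using c that by (simp add: K.inv_solve_right')
  have "c \<otimes>\<^bsub>K\<^esub> F x \<otimes>\<^bsub>K\<^esub> inv\<^bsub>K\<^esub> c = F x"
  proof (rule hom_eq_on_generate[OF G K conj_hom F S _ assms(7)])
    show "c \<otimes>\<^bsub>K\<^esub> F s \<otimes>\<^bsub>K\<^esub> inv\<^bsub>K\<^esub> c = F s" if "s \<in> S" for s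
      using conj_eq[OF hom_in_carrier[OF F subsetD[OF S that]]] comm[OF that] by simp
  qed
  then show ?thesis
    using conj_eq hom_in_carrier[OF F] group.generate_in_carrier[OF G S assms(7)] by simp
qed

section \<open>Coxeter presentations\<close>

lemma coxeter_relators_words: "r \<in> coxeter_relators X m \<Longrightarrow> r \<in> words X"
proof -
  have "concat (replicate n [(s, True), (t, True)]) \<in> words X" if "s \<in> X" "t \<in> X" for n s t
    using that by (induction n) auto
  then show "r \<in> coxeter_relators X m \<Longrightarrow> r \<in> words X" by (auto simp: coxeter_relators_def)
qed

lemma (in group) eval_word_power:
  assumes "f s \<in> carrier G" "f t \<in> carrier G"
  shows "eval_word G f (concat (replicate n [(s, True), (t, True)])) = (f s \<otimes> f t) [^] n"
proof (induction n)
  case (Suc n)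
  have "(f s \<otimes> f t) [^] Suc n = (f s \<otimes> f t) \<otimes> (f s \<otimes> f t) [^] n"
    using assms by (intro nat_pow_Suc2) simp
  then show ?case using Suc assms by (simp add: m_assoc del: nat_pow_Suc)
qed simp

lemma (in group) coxeter_hom_exists:
  assumes f: "f \<in> X \<rightarrow> carrier G"
    and rel: "\<And>s t. s \<in> X \<Longrightarrow> t \<in> X \<Longrightarrow> (f s \<otimes> f t) [^] m s t = \<one>"
  shows "\<exists>F \<in> hom (presented_group X (coxeter_relators X m)) G.
    \<forall>x\<in>X. F (presented_gen X (coxeter_relators X m) x) = f x"
proof (rule presented_group_hom_exists[OF f])
  fix r assume "r \<in> coxeter_relators X m"
  then show "eval_word G f r = \<one>"
    using f rel by (auto simp: coxeter_relators_def Pi_iff eval_word_power)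
qed

text \<open>
  A Coxeter system for which the Coxeter matrix is named; the matrices of the \<open>W v\<close> determine the
  matrix of the ambient Coxeter group.
\<close>

definition has_coxeter_presentation :: "('a, 'b) monoid_scheme \<Rightarrow> 'a set \<Rightarrow> ('a \<Rightarrow> 'a \<Rightarrow> nat) \<Rightarrow> bool" where
  "has_coxeter_presentation W S m \<longleftrightarrow> group W \<and> S \<subseteq> carrier W \<and> coxeter_matrix S m \<and>
    (\<exists>h \<in> iso (presented_group S (coxeter_relators S m)) W.
      \<forall>s\<in>S. h (presented_gen S (coxeter_relators S m) s) = s)"

lemma coxeter_presentation_hom_exists:
  assumes W: "has_coxeter_presentation W S m" and G: "group G" and f: "f \<in> S \<rightarrow> carrier G"
    and rel: "\<And>s t. s \<in> S \<Longrightarrow> t \<in> S \<Longrightarrow> (f s \<otimes>\<^bsub>G\<^esub> f t) [^]\<^bsub>G\<^esub> m s t = \<one>\<^bsub>G\<^esub>"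
  shows "\<exists>F \<in> hom W G. \<forall>s\<in>S. F s = f s"
proof -
  let ?D = "presented_group S (coxeter_relators S m)"
  interpret G: group G by (rule G)
  interpret D: group ?D by (rule group_presented_group)
  obtain h where h: "h \<in> iso ?D W" "\<And>s. s \<in> S \<Longrightarrow> h (presented_gen S (coxeter_relators S m) s) = s"
    using W by (auto simp: has_coxeter_presentation_def)
  obtain F where F: "F \<in> hom ?D G" "\<And>s. s \<in> S \<Longrightarrow> F (presented_gen S (coxeter_relators S m) s) = f s"
    using G.coxeter_hom_exists[of f S m] f rel by blast
  have "inv_into (carrier ?D) h \<in> hom W ?D"
    using D.iso_set_sym[OF h(1)] by (simp add: iso_def)
  then have "F \<circ> inv_into (carrier ?D) h \<in> hom W G" using F(1) by (rule hom_compose)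
  moreover have "(F \<circ> inv_into (carrier ?D) h) s = f s" if "s \<in> S" for s
  proof -
    have "inv_into (carrier ?D) h s = presented_gen S (coxeter_relators S m) s"
    proof (rule inv_into_f_eq)
      show "inj_on h (carrier ?D)" using h(1) by (simp add: iso_def bij_betw_def)
    qed (use h(2) that in \<open>auto intro: presented_gen_closed\<close>)
    then show ?thesis using F(2)[OF that] by simp
  qed
  ultimately show ?thesis by blast
qed

lemma coxeter_presentation_order:
  assumes W: "has_coxeter_presentation W S m" and s: "s \<in> S" and t: "t \<in> S"
  shows "(s \<otimes>\<^bsub>W\<^esub> t) [^]\<^bsub>W\<^esub> m s t = \<one>\<^bsub>W\<^esub>"
proof -
  let ?R = "coxeter_relators S m"
  let ?D = "presented_group S ?R"
  interpret W: group W using W by (simp add: has_coxeter_presentation_def)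
  interpret D: group ?D by (rule group_presented_group)
  obtain h where h: "h \<in> iso ?D W" "\<And>s. s \<in> S \<Longrightarrow> h (presented_gen S ?R s) = s"
    using W by (auto simp: has_coxeter_presentation_def)
  interpret h: group_hom ?D W h by unfold_locales (use h in \<open>simp add: iso_def\<close>)
  let ?r = "concat (replicate (m s t) [(s, True), (t, True)])"
  have "?r \<in> ?R" using s t by (auto simp: coxeter_relators_def)
  then have "eval_word ?D (presented_gen S ?R) ?r = \<one>\<^bsub>?D\<^esub>"
    using coxeter_relators_words by (intro presented_group_relator)
  then have "h ((presented_gen S ?R s \<otimes>\<^bsub>?D\<^esub> presented_gen S ?R t) [^]\<^bsub>?D\<^esub> m s t) = \<one>\<^bsub>W\<^esub>"
    using s t by (simp add: D.eval_word_power presented_gen_closed)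
  then show ?thesis
    using h(2) s t by (simp add: h.hom_nat_pow presented_gen_closed)
qed

lemma coxeter_presentation_generate:
  assumes W: "has_coxeter_presentation W S m"
  shows "carrier W = generate W S"
proof
  let ?R = "coxeter_relators S m"
  let ?D = "presented_group S ?R"
  interpret W: group W using W by (simp add: has_coxeter_presentation_def)
  interpret D: group ?D by (rule group_presented_group)
  have S: "S \<subseteq> carrier W" using W by (simp add: has_coxeter_presentation_def)
  obtain h where h: "h \<in> iso ?D W" "\<And>s. s \<in> S \<Longrightarrow> h (presented_gen S ?R s) = s"
    using W by (auto simp: has_coxeter_presentation_def)
  interpret h: group_hom ?D W h by unfold_locales (use h in \<open>simp add: iso_def\<close>)
  have "h (eval_word ?D (presented_gen S ?R) u) \<in> generate W S" if "u \<in> words S" for u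
    using that
  proof (induction u)
    case Nil
    then show ?case by (simp add: generate.one)
  next
    case (Cons p u)
    then have x: "fst p \<in> S" and u: "eval_word ?D (presented_gen S ?R) u \<in> carrier ?D"
      by (auto simp: eval_word_presented_gen presented_group_carrierI)
    show ?case
      using Cons x u h(2)[OF x]
      by (cases "snd p") (auto simp: presented_gen_closed intro: generate.intros)
  qed
  then have closed: "h A \<in> generate W S" if "A \<in> carrier ?D" for A
    using that by (elim presented_group_carrierE) (simp add: eval_word_presented_gen)
  have image: "h ` carrier ?D = carrier W" using h(1) by (auto simp: iso_def bij_betw_def)
  show "carrier W \<subseteq> generate W S"
  proof
    fix x assume "x \<in> carrier W"
    then obtain A where "A \<in> carrier ?D" "x = h A" using image by auto
    then show "x \<in> generate W S" using closed by simp
  qed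
  show "generate W S \<subseteq> carrier W" using S by (rule W.generate_incl)
qed

section \<open>Faithful actions on a real coordinate space\<close>

text \<open>
  Linearity of a group with elements of type \<open>'g\<close> asks for a field inside \<open>'g + real\<close>; this is the
  right-hand copy of the reals.
\<close>

definition inr_real_field :: "('g + real) ring" where
  "inr_real_field =
    \<lparr>carrier = range Inr, monoid.mult = (\<lambda>a b. Inr (projr a * projr b)), one = Inr 1,
     zero = Inr 0, add = (\<lambda>a b. Inr (projr a + projr b))\<rparr>"

lemma inr_real_field_simps [simp]:
  "carrier inr_real_field = range Inr"
  "a \<otimes>\<^bsub>inr_real_field\<^esub> b = Inr (projr a * projr b)"
  "a \<oplus>\<^bsub>inr_real_field\<^esub> b = Inr (projr a + projr b)"
  "\<one>\<^bsub>inr_real_field\<^esub> = Inr 1" "\<zero>\<^bsub>inr_real_field\<^esub> = Inr 0"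
  by (simp_all add: inr_real_field_def)

lemma field_inr_real_field: "field inr_real_field"
proof -
  have "cring (inr_real_field :: ('g + real) ring)"
  proof (rule cringI)
    show "abelian_group (inr_real_field :: ('g + real) ring)"
    proof (rule abelian_groupI)
      show "\<exists>y\<in>carrier inr_real_field. y \<oplus>\<^bsub>inr_real_field\<^esub> x = \<zero>\<^bsub>inr_real_field\<^esub>"
        if "x \<in> carrier inr_real_field" for x :: "'g + real"
        by (rule bexI[of _ "Inr (- projr x)"]) auto
    qed auto
    show "comm_monoid (inr_real_field :: ('g + real) ring)"
      by (rule comm_monoidI) auto
  qed (auto simp: algebra_simps)
  then show ?thesis
  proof (rule cring.cring_fieldI2)
    show "\<exists>b\<in>carrier inr_real_field. a \<otimes>\<^bsub>inr_real_field\<^esub> b = \<one>\<^bsub>inr_real_field\<^esub>"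
      if a: "a \<in> carrier inr_real_field" "a \<noteq> \<zero>\<^bsub>inr_real_field\<^esub>" for a :: "'g + real"
    proof -
      obtain x where x: "a = Inr x" using a(1) by auto
      then have "x \<noteq> 0" using a(2) by simp
      with x show ?thesis by (intro bexI[of _ "Inr (inverse x)"]) auto
    qed
  qed simp
qed

lemma finsum_inr_real_field:
  assumes "finite A"
  shows "(\<Oplus>\<^bsub>inr_real_field\<^esub>k\<in>A. Inr (f k)) = (Inr (\<Sum>k\<in>A. f k) :: 'g + real)"
proof -
  interpret K: field "inr_real_field :: ('g + real) ring" by (rule field_inr_real_field)
  show ?thesis
    using assms
  proof (induction A)
    case empty
    show ?case by simp
  next
    case (insert x A)
    have "(\<lambda>k. Inr (f k) :: 'g + real) \<in> insert x A \<rightarrow> carrier inr_real_field"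
      by simp
    with insert show ?case
      by (subst K.finsum_insert) auto
  qed
qed

definition unit_vec :: "'x \<Rightarrow> 'x \<Rightarrow> real" where
  "unit_vec s = (\<lambda>u. if u = s then 1 else 0)"

text \<open>
  Vectors are functions on the whole type, but only the coordinates in \<open>X\<close> count. A map is linear in
  this sense if its \<open>X\<close>-coordinates are those of multiplication by the matrix with columns
  \<open>f (unit_vec t)\<close>.
\<close>

definition linear_on :: "'x set \<Rightarrow> (('x \<Rightarrow> real) \<Rightarrow> 'x \<Rightarrow> real) \<Rightarrow> bool" where
  "linear_on X f \<longleftrightarrow> (\<forall>x. \<forall>u\<in>X. f x u = (\<Sum>t\<in>X. x t * f (unit_vec t) u))"

lemma linear_group_if_faithful_action:
  fixes G :: "('g, 'b) monoid_scheme" and \<rho> :: "'g \<Rightarrow> ('x \<Rightarrow> real) \<Rightarrow> 'x \<Rightarrow> real"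
  assumes G: "group G" and X: "finite X"
    and lin: "\<And>g. g \<in> carrier G \<Longrightarrow> linear_on X (\<rho> g)"
    and mult: "\<And>g h x. g \<in> carrier G \<Longrightarrow> h \<in> carrier G \<Longrightarrow> \<rho> (g \<otimes>\<^bsub>G\<^esub> h) x = \<rho> g (\<rho> h x)"
    and one: "\<And>x. \<rho> \<one>\<^bsub>G\<^esub> x = x"
    and faithful: "\<And>g. g \<in> carrier G \<Longrightarrow>
      (\<And>s u. s \<in> X \<Longrightarrow> u \<in> X \<Longrightarrow> \<rho> g (unit_vec s) u = unit_vec s u) \<Longrightarrow> g = \<one>\<^bsub>G\<^esub>"
  shows "linear_group G"
proof -
  interpret G: group G by (rule G)
  let ?K = "inr_real_field :: ('g + real) ring"
  define n where "n = card X"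
  obtain b where b: "bij_betw b {..<n} X"
    using ex_bij_betw_nat_finite[OF X] by (auto simp: n_def atLeast0LessThan)
  define M :: "'g \<Rightarrow> nat \<times> nat \<Rightarrow> 'g + real" where
    "M g = (\<lambda>(i, j)\<in>{..<n} \<times> {..<n}. Inr (\<rho> g (unit_vec (b j)) (b i)))" for g
  let ?MM = "matrix_monoid ?K n"
  have bX: "b i \<in> X" if "i < n" for i
    using b that by (auto simp: bij_betw_def)
  have b_eq: "b i = b j \<longleftrightarrow> i = j" if "i < n" "j < n" for i j
    using b that by (auto simp: bij_betw_def inj_on_def)
  have M_carrier: "M g \<in> carrier ?MM" for g
    by (auto simp: M_def matrix_monoid_def)
  have M_one: "M \<one>\<^bsub>G\<^esub> = \<one>\<^bsub>?MM\<^esub>"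
    by (auto simp: M_def matrix_monoid_def one unit_vec_def b_eq fun_eq_iff
        restrict_def)
  have M_mult: "M (g \<otimes>\<^bsub>G\<^esub> h) = M g \<otimes>\<^bsub>?MM\<^esub> M h" if g: "g \<in> carrier G" and h: "h \<in> carrier G" for g h
  proof
    fix p :: "nat \<times> nat"
    obtain i j where p: "p = (i, j)" by force
    show "M (g \<otimes>\<^bsub>G\<^esub> h) p = (M g \<otimes>\<^bsub>?MM\<^esub> M h) p"
    proof (cases "i < n \<and> j < n")
      case True
      have "\<rho> (g \<otimes>\<^bsub>G\<^esub> h) (unit_vec (b j)) (b i)
          = (\<Sum>t\<in>X. \<rho> h (unit_vec (b j)) t * \<rho> g (unit_vec t) (b i))"
        using lin[OF g] bX True by (auto simp: mult[OF g h] linear_on_def)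
      also have "\<dots> = (\<Sum>k<n. \<rho> h (unit_vec (b j)) (b k) * \<rho> g (unit_vec (b k)) (b i))"
        by (rule sum.reindex_bij_betw[OF b, symmetric])
      finally have "M (g \<otimes>\<^bsub>G\<^esub> h) p
          = (\<Oplus>\<^bsub>?K\<^esub>k\<in>{..<n}. Inr (\<rho> g (unit_vec (b k)) (b i) * \<rho> h (unit_vec (b j)) (b k)))"
        using True by (simp add: finsum_inr_real_field M_def p mult.commute)
      also have "\<dots> = (\<Oplus>\<^bsub>?K\<^esub>k\<in>{..<n}. M g (i, k) \<otimes>\<^bsub>?K\<^esub> M h (k, j))"
      proof -
        interpret K: field ?K by (rule field_inr_real_field)
        show ?thesis
          by (rule K.finsum_cong') (use True in \<open>auto simp: M_def\<close>)
      qed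
      also have "\<dots> = (M g \<otimes>\<^bsub>?MM\<^esub> M h) p"
        using True by (simp add: matrix_monoid_def p)
      finally show ?thesis .
    next
      case False
      then show ?thesis by (auto simp: M_def matrix_monoid_def p)
    qed
  qed
  have "M g \<in> Units ?MM" if "g \<in> carrier G" for g
    unfolding Units_def using that M_carrier
    by (auto intro!: bexI[of _ "M (inv\<^bsub>G\<^esub> g)"] simp: M_mult[symmetric] M_one)
  then have hom: "M \<in> hom G (general_linear_group ?K n)"
    by (auto simp: hom_def general_linear_group_def units_of_def M_mult)
  have inj: "inj_on M (carrier G)"
  proof (rule inj_onI)
    fix g h assume g: "g \<in> carrier G" and h: "h \<in> carrier G" and eq: "M g = M h"
    have M_eq_one: "M (inv\<^bsub>G\<^esub> h \<otimes>\<^bsub>G\<^esub> g) = \<one>\<^bsub>?MM\<^esub>"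
      using g h by (simp add: M_mult eq) (simp add: M_mult[symmetric] M_one)
    have entry: "Inr (\<rho> (inv\<^bsub>G\<^esub> h \<otimes>\<^bsub>G\<^esub> g) (unit_vec (b j)) (b i))
        = (Inr (if i = j then 1 else 0) :: 'g + real)" if "i < n" "j < n" for i j
    proof -
      have "M (inv\<^bsub>G\<^esub> h \<otimes>\<^bsub>G\<^esub> g) (i, j) = \<one>\<^bsub>?MM\<^esub> (i, j)"
        using M_eq_one by (rule fun_cong)
      then show ?thesis using that by (simp add: M_def matrix_monoid_def split: if_splits)
    qed
    have "inv\<^bsub>G\<^esub> h \<otimes>\<^bsub>G\<^esub> g = \<one>\<^bsub>G\<^esub>"
    proof (rule faithful)
      fix s u assume "s \<in> X" "u \<in> X"
      then obtain i j where "i < n" "j < n" "u = b i" "s = b j"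
        using b by (auto simp: bij_betw_def)
      then show "\<rho> (inv\<^bsub>G\<^esub> h \<otimes>\<^bsub>G\<^esub> g) (unit_vec s) u = unit_vec s u"
        using entry[of i j] by (auto simp: unit_vec_def b_eq)
    qed (use g h in simp)
    then show "g = h" using g h by (metis G.inv_closed G.inv_equality G.inv_inv)
  qed
  show ?thesis
    unfolding linear_group_def using hom inj field_inr_real_field by blast
qed

section \<open>The reflection representation of a Coxeter group\<close>

text \<open>
  The reflection representation on the space with basis \<open>X\<close>. The numbers \<open>c s t\<close> are the negatives of
  the values of the canonical bilinear form on the basis vectors, so that \<open>reflect s\<close> below is the
  reflection \<open>x \<mapsto> x - 2 B(e\<^sub>s, x) e\<^sub>s\<close>.
\<close>

locale coxeter_data =
  fixes X :: "'x set" and m :: "'x \<Rightarrow> 'x \<Rightarrow> nat"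
  assumes X_finite: "finite X" and m: "coxeter_matrix X m"
begin

lemma m_refl: "s \<in> X \<Longrightarrow> m s s = 1"
  and m_sym: "s \<in> X \<Longrightarrow> t \<in> X \<Longrightarrow> m s t = m t s"
  and m_neq: "s \<in> X \<Longrightarrow> t \<in> X \<Longrightarrow> s \<noteq> t \<Longrightarrow> m s t \<noteq> 1"
  using m by (auto simp: coxeter_matrix_def)

definition c :: "'x \<Rightarrow> 'x \<Rightarrow> real" where
  "c s t = (if m s t = 0 then 1 else cos (pi / m s t))"

definition reflect :: "'x \<Rightarrow> ('x \<Rightarrow> real) \<Rightarrow> 'x \<Rightarrow> real" where
  "reflect s x = x(s := x s + 2 * (\<Sum>t\<in>X. c s t * x t))"

abbreviation reflects :: "'x list \<Rightarrow> ('x \<Rightarrow> real) \<Rightarrow> 'x \<Rightarrow> real" where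
  "reflects \<equiv> foldr reflect"

lemma c_refl: "s \<in> X \<Longrightarrow> c s s = -1"
  by (simp add: c_def m_refl)

lemma c_sym: "s \<in> X \<Longrightarrow> t \<in> X \<Longrightarrow> c s t = c t s"
  by (simp add: c_def m_sym)

lemma reflect_lincomb:
  "reflect s (\<lambda>u. a * x u + b * y u) = (\<lambda>u. a * reflect s x u + b * reflect s y u)"
  by (auto simp: reflect_def fun_eq_iff algebra_simps sum.distrib sum_distrib_left)

lemma reflects_lincomb:
  "reflects w (\<lambda>u. a * x u + b * y u) = (\<lambda>u. a * reflects w x u + b * reflects w y u)"
  by (induction w) (simp_all add: reflect_lincomb)

lemma reflects_uminus: "reflects w (\<lambda>u. - x u) = (\<lambda>u. - reflects w x u)"
  using reflects_lincomb[of w "-1" x 0 x] by simp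

lemma reflect_unit_vec:
  assumes "s \<in> X" "t \<in> X"
  shows "reflect s (unit_vec t) = (\<lambda>u. unit_vec t u + 2 * c s t * unit_vec s u)"
proof -
  have "(\<Sum>v\<in>X. c s v * unit_vec t v) = c s t"
    using assms X_finite by (simp add: unit_vec_def if_distrib cong: if_cong)
  then show ?thesis by (auto simp: reflect_def unit_vec_def)
qed

lemma reflect_unit_vec_same: "s \<in> X \<Longrightarrow> reflect s (unit_vec s) = (\<lambda>u. - unit_vec s u)"
  by (auto simp: reflect_unit_vec c_refl)

lemma reflect_involution: "s \<in> X \<Longrightarrow> reflect s (reflect s x) = x"
proof -
  assume s: "s \<in> X"
  have "reflect s x = (\<lambda>u. 1 * x u + (2 * (\<Sum>t\<in>X. c s t * x t)) * unit_vec s u)"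
    by (auto simp: reflect_def unit_vec_def)
  then have "reflect s (reflect s x) =
      (\<lambda>u. 1 * reflect s x u + (2 * (\<Sum>t\<in>X. c s t * x t)) * reflect s (unit_vec s) u)"
    by (simp only: reflect_lincomb)
  then show ?thesis using s by (auto simp: reflect_unit_vec_same) (auto simp: reflect_def unit_vec_def)
qed

lemma bij_reflect: "s \<in> X \<Longrightarrow> bij (reflect s)"
  by (rule involuntory_imp_bij) (rule reflect_involution)

lemma linear_on_reflects: "set w \<subseteq> X \<Longrightarrow> linear_on X (reflects w)"
proof (induction w)
  case Nil
  show ?case
    using X_finite by (auto simp: linear_on_def unit_vec_def if_distrib cong: if_cong)
next
  case (Cons s w)
  then have IH: "reflects w x u = (\<Sum>t\<in>X. x t * reflects w (unit_vec t) u)" if "u \<in> X" for x u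
    using that by (auto simp: linear_on_def)
  have "reflects (s # w) x u = (\<Sum>t\<in>X. x t * reflects (s # w) (unit_vec t) u)" if "u \<in> X" for x u
  proof -
    have "(\<Sum>v\<in>X. c s v * reflects w x v)
        = (\<Sum>v\<in>X. \<Sum>t\<in>X. x t * (c s v * reflects w (unit_vec t) v))"
      by (rule sum.cong[OF HOL.refl]) (simp add: IH[of _ x] sum_distrib_left algebra_simps)
    also have "\<dots> = (\<Sum>t\<in>X. x t * (\<Sum>v\<in>X. c s v * reflects w (unit_vec t) v))"
      by (subst sum.swap) (simp add: sum_distrib_left)
    finally show ?thesis
      using IH[OF that, of x]
      by (auto simp: reflect_def distrib_left sum.distrib sum_distrib_left mult.left_commute)
  qed
  then show ?case by (simp add: linear_on_def)
qed

subsection \<open>Dihedral subgroups\<close>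

text \<open>
  The alternating word of length \<open>k\<close> whose last letter is \<open>s\<close>. It grows at the front because words act
  from the right end.
\<close>

primrec alt :: "'y \<Rightarrow> 'y \<Rightarrow> nat \<Rightarrow> 'y list" where
  "alt s t 0 = []"
| "alt s t (Suc k) = (if even k then s else t) # alt s t k"

lemma length_alt [simp]: "length (alt s t k) = k"
  by (induction k) auto

lemma set_alt: "set (alt s t k) \<subseteq> {s, t}"
  by (induction k) auto

lemma alt_snoc: "alt t s k @ [s] = alt s t (Suc k)"
  by (induction k) auto

lemma alt_split: "\<exists>p. length p = j \<and> set p \<subseteq> {s, t} \<and> alt s t (j + k) = p @ alt s t k"
proof (induction j)
  case (Suc j)
  then obtain p where "length p = j" "set p \<subseteq> {s, t}" "alt s t (j + k) = p @ alt s t k" by blast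
  then show ?case by (intro exI[of _ "(if even (j + k) then s else t) # p"]) auto
qed simp

lemma alt_double: "alt t s (2 * n) = concat (replicate n [s, t])"
  by (induction n) auto

text \<open>
  The ratio \<open>sin (k \<theta>) / sin \<theta>\<close> for \<open>\<theta> = \<pi> / m s t\<close>, and its limit \<open>k\<close> for \<open>\<theta> \<rightarrow> 0\<close> when
  \<open>m s t = \<infinity>\<close>. As a function of \<open>k\<close> it solves the recursion of the coordinates in
  \<open>reflects_alt\<close>: each further reflection in the plane of \<open>s\<close> and \<open>t\<close> changes one of the two
  coordinates \<open>(a, b)\<close>, replacing \<open>a\<close> by \<open>2 c s t * b - a\<close> or \<open>b\<close> by \<open>2 c s t * a - b\<close>.
\<close>

definition dsin :: "'x \<Rightarrow> 'x \<Rightarrow> nat \<Rightarrow> real" where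
  "dsin s t k = (if m s t = 0 then real k else sin (k * (pi / m s t)) / sin (pi / m s t))"

lemma sin_angle_pos:
  assumes "s \<in> X" "t \<in> X" "s \<noteq> t" "m s t \<noteq> 0"
  shows "sin (pi / m s t) > 0"
proof (rule sin_gt_zero)
  have "m s t > 1" using assms m_neq[of s t] by linarith
  then show "pi / m s t < pi" by (simp add: divide_less_eq)
qed (use assms in simp)

lemma dsin_0: "dsin s t 0 = 0"
  by (simp add: dsin_def)

lemma dsin_1: "s \<in> X \<Longrightarrow> t \<in> X \<Longrightarrow> s \<noteq> t \<Longrightarrow> dsin s t (Suc 0) = 1"
  using sin_angle_pos[of s t] by (cases "m s t = 0") (auto simp: dsin_def)

lemma dsin_rec: "dsin s t (Suc (Suc k)) = 2 * c s t * dsin s t (Suc k) - dsin s t k"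
proof (cases "m s t = 0")
  case False
  define \<theta> where "\<theta> = pi / m s t"
  have "sin (k * \<theta>) + sin (Suc (Suc k) * \<theta>) = 2 * cos \<theta> * sin (Suc k * \<theta>)"
    using sin_add[of "Suc k * \<theta>" \<theta>] sin_diff[of "Suc k * \<theta>" \<theta>] by (simp add: algebra_simps)
  then have "sin (Suc (Suc k) * \<theta>) / sin \<theta>
      = 2 * cos \<theta> * (sin (Suc k * \<theta>) / sin \<theta>) - sin (k * \<theta>) / sin \<theta>"
    by (simp add: diff_divide_distrib[symmetric])
  then show ?thesis using False by (simp add: dsin_def c_def \<theta>_def)
qed (simp add: dsin_def c_def)

lemma dsin_nonneg:
  assumes "s \<in> X" "t \<in> X" "s \<noteq> t" "m s t \<noteq> 0 \<Longrightarrow> k \<le> m s t"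
  shows "dsin s t k \<ge> 0"
proof (cases "m s t = 0")
  case False
  have "real k \<le> real (m s t)" using assms(4)[OF False] by simp
  then have "k * (pi / m s t) \<le> pi"
    using False by (simp add: field_simps)
  then have "sin (k * (pi / m s t)) \<ge> 0" by (intro sin_ge_zero) auto
  then show ?thesis using False sin_angle_pos[OF assms(1-3) False] by (simp add: dsin_def)
qed (simp add: dsin_def)

lemma reflects_alt:
  assumes s: "s \<in> X" and t: "t \<in> X" and "s \<noteq> t"
  shows "reflects (alt t s k) (unit_vec s) =
    (\<lambda>u. dsin s t (if even k then Suc k else k) * unit_vec s u
       + dsin s t (if even k then k else Suc k) * unit_vec t u)"
proof (induction k)
  case 0
  then show ?case using assms by (simp add: dsin_0 dsin_1)
next
  case (Suc k)
  show ?case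
    using s t
    by (cases "even k")
       (simp_all add: Suc reflect_lincomb reflect_unit_vec c_refl c_sym[of t s] dsin_rec fun_eq_iff
          distrib_left left_diff_distrib)
qed

text \<open>
  At \<open>k = 2 m s t\<close> the angle \<open>k \<theta>\<close> is \<open>2 \<pi>\<close>. For the second basis vector the last letter of the word
  acts by a sign, after which the formula applies with the roles of \<open>s\<close> and \<open>t\<close> exchanged.
\<close>

lemma reflects_alt_fixes_plane:
  assumes s: "s \<in> X" and t: "t \<in> X" and "s \<noteq> t" and fin: "m s t \<noteq> 0"
  shows "reflects (alt t s (2 * m s t)) (unit_vec s) = unit_vec s"
    and "reflects (alt t s (2 * m s t)) (unit_vec t) = unit_vec t"
proof -
  note pos = sin_angle_pos[OF s t \<open>s \<noteq> t\<close> fin]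
  have 0: "dsin s t (2 * m s t) = 0" using fin by (simp add: dsin_def)
  have 1: "dsin s t (Suc (2 * m s t)) = 1"
  proof -
    have "Suc (2 * m s t) * (pi / m s t) = pi / m s t + 2 * pi" using fin by (simp add: field_simps)
    then show ?thesis using fin pos by (simp add: dsin_def del: of_nat_Suc)
  qed
  show "reflects (alt t s (2 * m s t)) (unit_vec s) = unit_vec s"
    using assms by (simp add: reflects_alt 0 1)
  obtain k where k: "2 * m s t = Suc k" using fin by (cases "2 * m s t") auto
  have odd: "odd k" using k by (metis even_Suc even_mult_iff even_numeral)
  have 2: "dsin s t k = -1"
    using dsin_rec[of s t k] 0 1 by (simp add: k)
  have ts: "dsin t s = dsin s t" using s t by (auto simp: dsin_def fun_eq_iff m_sym)
  have "reflects (alt t s (2 * m s t)) (unit_vec t) = reflects (alt s t k) (reflect t (unit_vec t))"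
    by (simp only: k alt_snoc[symmetric] foldr_append) simp
  also have "\<dots> = (\<lambda>u. - reflects (alt s t k) (unit_vec t) u)"
    using t by (simp add: reflect_unit_vec_same reflects_uminus)
  also have "\<dots> = unit_vec t"
    using assms odd 0 2 k by (simp add: reflects_alt ts)
  finally show "reflects (alt t s (2 * m s t)) (unit_vec t) = unit_vec t" .
qed

text \<open>
  For finite \<open>m s t\<close> the form is nondegenerate on the plane of \<open>s\<close> and \<open>t\<close>, so every vector is the sum
  of a vector of the plane and a vector \<open>y\<close> orthogonal to it, which both reflections fix.
\<close>

lemma reflects_alt_order:
  assumes s: "s \<in> X" and t: "t \<in> X" and st: "s \<noteq> t" and fin: "m s t \<noteq> 0"
  shows "reflects (alt t s (2 * m s t)) x = x"
proof -
  define cc where "cc = c s t"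
  have "sin (pi / m s t) \<noteq> 0" using sin_angle_pos[OF assms] by simp
  then have cc: "1 - cc\<^sup>2 \<noteq> 0"
    using fin by (simp add: cc_def c_def cos_squared_eq)
  define p q where "p = (\<Sum>u\<in>X. c s u * x u)" and "q = (\<Sum>u\<in>X. c t u * x u)"
  \<comment> \<open>The solution of the linear system that makes \<open>y\<close> orthogonal to \<open>s\<close> and \<open>t\<close>; its determinant is \<open>1 - cc\<^sup>2\<close>.\<close>
  define \<alpha> \<beta> where "\<alpha> = (p + cc * q) / (1 - cc\<^sup>2)" and "\<beta> = (q + cc * p) / (1 - cc\<^sup>2)"
  define y where "y = (\<lambda>u. x u + \<alpha> * unit_vec s u + \<beta> * unit_vec t u)"
  have sum_unit: "(\<Sum>u\<in>X. c r u * unit_vec v u) = c r v" if "v \<in> X" for r v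
    using that X_finite by (simp add: unit_vec_def if_distrib cong: if_cong)
  have sum_y: "(\<Sum>u\<in>X. c r u * y u) = (\<Sum>u\<in>X. c r u * x u) + \<alpha> * c r s + \<beta> * c r t" for r
    using s t
    by (simp add: y_def distrib_left sum.distrib mult.left_commute[of "c _ _"]
        sum_distrib_left[symmetric] sum_unit)
  have "(\<Sum>u\<in>X. c s u * y u) = p - \<alpha> + \<beta> * cc" "(\<Sum>u\<in>X. c t u * y u) = q + \<alpha> * cc - \<beta>"
    using s t by (simp_all add: sum_y p_def q_def c_refl c_sym[of t s] cc_def)
  moreover have "p - \<alpha> + \<beta> * cc = 0" "q + \<alpha> * cc - \<beta> = 0"
    using cc by (simp_all add: \<alpha>_def \<beta>_def field_simps power2_eq_square)
  ultimately have y_fixed: "reflect s y = y" "reflect t y = y"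
    by (simp_all add: reflect_def)
  have "reflects w y = y" if "set w \<subseteq> {s, t}" for w
    using that by (induction w) (auto simp: y_fixed)
  then have y: "reflects (alt t s (2 * m s t)) y = y"
    using set_alt[of t s] by blast
  have "x = (\<lambda>u. 1 * y u + (-1) * (\<alpha> * unit_vec s u + \<beta> * unit_vec t u))"
    by (auto simp: y_def)
  then have "reflects (alt t s (2 * m s t)) x =
      reflects (alt t s (2 * m s t)) (\<lambda>u. 1 * y u + (-1) * (\<alpha> * unit_vec s u + \<beta> * unit_vec t u))"
    by simp
  also have "\<dots> = x"
    by (simp only: reflects_lincomb y reflects_alt_fixes_plane[OF assms]) (simp add: y_def)
  finally show ?thesis .
qed

subsection \<open>Words and length\<close>

definition C :: "'x word set monoid" where
  "C = presented_group X (coxeter_relators X m)"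

definition gen :: "'x \<Rightarrow> 'x word set" where
  "gen = presented_gen X (coxeter_relators X m)"

sublocale C: group C
  unfolding C_def by (rule group_presented_group)

lemma gen_closed [simp]: "s \<in> X \<Longrightarrow> gen s \<in> carrier C"
  by (simp add: gen_def C_def presented_gen_closed)

lemma gen_order:
  assumes "s \<in> X" "t \<in> X"
  shows "(gen s \<otimes>\<^bsub>C\<^esub> gen t) [^]\<^bsub>C\<^esub> m s t = \<one>\<^bsub>C\<^esub>"
proof -
  let ?r = "concat (replicate (m s t) [(s, True), (t, True)])"
  have "?r \<in> coxeter_relators X m"
    using assms by (auto simp: coxeter_relators_def)
  then have "eval_word C gen ?r = \<one>\<^bsub>C\<^esub>"
    unfolding C_def gen_def using coxeter_relators_words by (intro presented_group_relator)
  then show ?thesis using assms by (simp add: C.eval_word_power)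
qed

lemma gen_square: "s \<in> X \<Longrightarrow> gen s \<otimes>\<^bsub>C\<^esub> gen s = \<one>\<^bsub>C\<^esub>"
  using gen_order[of s s] by (simp add: m_refl)

lemma inv_gen: "s \<in> X \<Longrightarrow> inv\<^bsub>C\<^esub> gen s = gen s"
  by (simp add: C.inv_equality gen_square)

definition wprod :: "'x list \<Rightarrow> 'x word set" where
  "wprod w = foldr (\<lambda>s g. gen s \<otimes>\<^bsub>C\<^esub> g) w \<one>\<^bsub>C\<^esub>"

lemma wprod_simps [simp]: "wprod [] = \<one>\<^bsub>C\<^esub>" "wprod (s # w) = gen s \<otimes>\<^bsub>C\<^esub> wprod w"
  by (simp_all add: wprod_def)

lemma wprod_closed [simp]: "set w \<subseteq> X \<Longrightarrow> wprod w \<in> carrier C"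
  by (induction w) auto

lemma wprod_append: "set v \<subseteq> X \<Longrightarrow> set w \<subseteq> X \<Longrightarrow> wprod (v @ w) = wprod v \<otimes>\<^bsub>C\<^esub> wprod w"
  by (induction v) (auto simp: C.m_assoc)

lemma wprod_rev: "set w \<subseteq> X \<Longrightarrow> wprod (rev w) = inv\<^bsub>C\<^esub> wprod w"
  by (induction w) (auto simp: wprod_append C.inv_mult_group inv_gen)

lemma wprod_surj:
  assumes "g \<in> carrier C"
  obtains w where "set w \<subseteq> X" "wprod w = g"
proof -
  obtain u where u: "u \<in> words X" "g = word_cong X (coxeter_relators X m) `` {u}"
    using assms unfolding C_def by (elim presented_group_carrierE)
  have "eval_word C gen u = wprod (map fst u)"
    using u(1) by (induction u) (auto simp: inv_gen)
  moreover have "eval_word C gen u = g"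
    using u by (simp add: C_def gen_def eval_word_presented_gen)
  moreover have "set (map fst u) \<subseteq> X" using u(1) by (auto simp: words_def)
  ultimately show thesis using that by metis
qed

definition len :: "'x word set \<Rightarrow> nat" where
  "len g = (LEAST n. \<exists>w. set w \<subseteq> X \<and> wprod w = g \<and> length w = n)"

lemma len_wprod_le: "set w \<subseteq> X \<Longrightarrow> len (wprod w) \<le> length w"
  unfolding len_def by (rule Least_le) blast

lemma reduced_word:
  assumes "g \<in> carrier C"
  obtains w where "set w \<subseteq> X" "wprod w = g" "length w = len g"
proof -
  obtain w where "set w \<subseteq> X" "wprod w = g" using wprod_surj[OF assms] .
  then have "\<exists>n w. set w \<subseteq> X \<and> wprod w = g \<and> length w = n" by blast
  then have "\<exists>w. set w \<subseteq> X \<and> wprod w = g \<and> length w = len g"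
    unfolding len_def by (rule LeastI_ex)
  then show thesis using that by blast
qed

lemma len_mult_wprod_le:
  assumes "g \<in> carrier C" "set w \<subseteq> X"
  shows "len (g \<otimes>\<^bsub>C\<^esub> wprod w) \<le> len g + length w"
proof -
  obtain v where "set v \<subseteq> X" "wprod v = g" "length v = len g"
    using reduced_word[OF assms(1)] .
  then show ?thesis
    using len_wprod_le[of "v @ w"] assms(2) by (simp add: wprod_append)
qed

lemma wprod_alt_order:
  assumes "s \<in> X" "t \<in> X"
  shows "wprod (alt t s (2 * m s t)) = \<one>\<^bsub>C\<^esub>"
proof -
  have "wprod (alt t s (2 * n)) = (gen s \<otimes>\<^bsub>C\<^esub> gen t) [^]\<^bsub>C\<^esub> n" for n
  proof (induction n)
    case (Suc n)
    have "(gen s \<otimes>\<^bsub>C\<^esub> gen t) [^]\<^bsub>C\<^esub> Suc n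
        = (gen s \<otimes>\<^bsub>C\<^esub> gen t) \<otimes>\<^bsub>C\<^esub> (gen s \<otimes>\<^bsub>C\<^esub> gen t) [^]\<^bsub>C\<^esub> n"
      using assms by (intro C.nat_pow_Suc2) simp
    then show ?case using Suc assms by (simp add: C.m_assoc del: C.nat_pow_Suc)
  qed simp
  then show ?thesis using gen_order[OF assms] by simp
qed

text \<open>
  The alternating word of length \<open>2 m s t\<close> is trivial, so its suffix of length \<open>m s t + 1\<close> is the
  inverse of its prefix of length \<open>m s t - 1\<close>.
\<close>

lemma wprod_alt_shorter:
  assumes s: "s \<in> X" and t: "t \<in> X" and "m s t \<noteq> 0"
  obtains p where "set p \<subseteq> X" "length p < m s t" "wprod p = wprod (alt s t (Suc (m s t)))"
proof -
  obtain p where p: "length p = m s t - 1" "set p \<subseteq> {s, t}"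
      "alt s t (m s t - 1 + Suc (m s t)) = p @ alt s t (Suc (m s t))"
    using alt_split by meson
  have sub: "set p \<subseteq> X" "set (alt s t (Suc (m s t))) \<subseteq> X"
    using p(2) s t set_alt[of s t "Suc (m s t)"] by blast+
  have "m s t - 1 + Suc (m s t) = 2 * m t s" using assms by (simp add: m_sym)
  then have "wprod p \<otimes>\<^bsub>C\<^esub> wprod (alt s t (Suc (m s t))) = \<one>\<^bsub>C\<^esub>"
    using wprod_alt_order[OF t s] p(3) sub by (metis wprod_append)
  then have "wprod (rev p) = wprod (alt s t (Suc (m s t)))"
    using sub by (metis C.inv_equality C.inv_inv C.inv_closed wprod_closed wprod_rev)
  then show thesis using that[of "rev p"] sub p(1) assms(3) by simp
qed

subsection \<open>Faithfulness\<close>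

definition rep :: "'x word set \<Rightarrow> ('x \<Rightarrow> real) \<Rightarrow> 'x \<Rightarrow> real" where
  "rep = (SOME F. F \<in> hom C (BijGroup UNIV) \<and> (\<forall>s\<in>X. F (gen s) = reflect s))"

lemma reflects_replicate: "reflects (concat (replicate n [s, t])) = (reflect s \<circ> reflect t) ^^ n"
  by (induction n) auto

lemma rep_hom: "rep \<in> hom C (BijGroup UNIV)" and rep_gen: "s \<in> X \<Longrightarrow> rep (gen s) = reflect s"
proof -
  interpret B: group "BijGroup (UNIV :: ('x \<Rightarrow> real) set)" by (rule group_BijGroup)
  have "\<exists>F \<in> hom C (BijGroup UNIV). \<forall>s\<in>X. F (gen s) = reflect s"
    unfolding C_def gen_def
  proof (rule B.coxeter_hom_exists)
    show "reflect \<in> X \<rightarrow> carrier (BijGroup UNIV)"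
      by (auto simp: carrier_BijGroup_UNIV bij_reflect)
    show "(reflect s \<otimes>\<^bsub>BijGroup UNIV\<^esub> reflect t) [^]\<^bsub>BijGroup UNIV\<^esub> m s t = \<one>\<^bsub>BijGroup UNIV\<^esub>"
      if s: "s \<in> X" and t: "t \<in> X" for s t
    proof -
      have st: "reflect s \<otimes>\<^bsub>BijGroup UNIV\<^esub> reflect t = reflect s \<circ> reflect t"
        using s t by (simp add: mult_BijGroup_UNIV bij_reflect)
      have bij: "bij ((reflect s \<circ> reflect t) ^^ n)" for n
        using s t by (intro bij_fn bij_comp bij_reflect)
      have "(reflect s \<circ> reflect t) [^]\<^bsub>BijGroup UNIV\<^esub> n = (reflect s \<circ> reflect t) ^^ n" for n :: nat
      proof (induction n)
        case (Suc n)
        have "(reflect s \<circ> reflect t) ^^ n \<otimes>\<^bsub>BijGroup UNIV\<^esub> (reflect s \<circ> reflect t)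
            = (reflect s \<circ> reflect t) ^^ Suc n"
          using mult_BijGroup_UNIV[OF bij[of n] bij[of 1]] by (simp only: funpow_Suc_right funpow_0 One_nat_def) simp
        then show ?case by (simp only: B.nat_pow_Suc Suc)
      qed (simp add: one_BijGroup_UNIV)
      then have pow: "(reflect s \<otimes>\<^bsub>BijGroup UNIV\<^esub> reflect t) [^]\<^bsub>BijGroup UNIV\<^esub> n = reflects (alt t s (2 * n))"
        for n :: nat by (simp add: st alt_double reflects_replicate)
      show ?thesis
      proof (cases "s = t")
        case True
        have "reflects (alt s s 2) = id"
          using s by (simp add: numeral_2_eq_2 fun_eq_iff reflect_involution)
        then show ?thesis
          using s True pow[of 1] by (simp add: m_refl one_BijGroup_UNIV del: B.nat_pow_Suc)
      next
        case False
        show ?thesis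
          using s t False
          by (cases "m s t = 0") (auto simp: pow one_BijGroup_UNIV reflects_alt_order)
      qed
    qed
  qed
  then have "\<exists>F. F \<in> hom C (BijGroup UNIV) \<and> (\<forall>s\<in>X. F (gen s) = reflect s)" by blast
  from someI_ex[OF this] show "rep \<in> hom C (BijGroup UNIV)"
    and "s \<in> X \<Longrightarrow> rep (gen s) = reflect s"
    unfolding rep_def by blast+
qed

lemma rep_one: "rep \<one>\<^bsub>C\<^esub> x = x"
  using hom_one[OF rep_hom C.is_group group_BijGroup] by (simp add: one_BijGroup_UNIV)

lemma rep_mult:
  assumes "g \<in> carrier C" "h \<in> carrier C"
  shows "rep (g \<otimes>\<^bsub>C\<^esub> h) x = rep g (rep h x)"
proof -
  have "bij (rep g)" "bij (rep h)"
    using hom_in_carrier[OF rep_hom] assms by (auto simp: carrier_BijGroup_UNIV)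
  then show ?thesis using hom_mult[OF rep_hom assms] by (simp add: mult_BijGroup_UNIV)
qed

lemma rep_wprod: "set w \<subseteq> X \<Longrightarrow> rep (wprod w) x = reflects w x"
  by (induction w) (auto simp: rep_one rep_mult rep_gen)

lemma rep_lincomb:
  assumes "g \<in> carrier C"
  shows "rep g (\<lambda>u. a * x u + b * y u) = (\<lambda>u. a * rep g x u + b * rep g y u)"
proof -
  obtain w where w: "set w \<subseteq> X" "wprod w = g" using wprod_surj[OF assms] .
  have "rep g = reflects w" using w rep_wprod by auto
  then show ?thesis by (simp only: reflects_lincomb)
qed

lemma linear_on_rep:
  assumes "g \<in> carrier C"
  shows "linear_on X (rep g)"
proof -
  obtain w where w: "set w \<subseteq> X" "wprod w = g" using wprod_surj[OF assms] .
  have "rep g = reflects w" using w rep_wprod by auto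
  then show ?thesis using linear_on_reflects[OF w(1)] by simp
qed

text \<open>
  Induction on the length of \<open>g\<close>. Let \<open>t\<close> be the last letter of a reduced word of \<open>g\<close>; then
  \<open>t \<noteq> s\<close>. Write \<open>g = v u\<close> with \<open>u\<close> an alternating word in \<open>s\<close>, \<open>t\<close> that ends in \<open>t\<close>, with lengths
  adding up and \<open>u\<close> as long as possible. Then neither \<open>s\<close> nor \<open>t\<close> shortens \<open>v\<close>: one of them would make
  \<open>u\<close> longer, and the other would make \<open>g\<close> shorter. So the induction hypothesis applies to \<open>v\<close> with both
  letters. The length of \<open>u\<close> is less than \<open>m s t\<close>, because otherwise \<open>wprod_alt_shorter\<close> would make
  \<open>g s\<close> shorter than \<open>g\<close>. Within this range \<open>u\<close> maps the basis vector of \<open>s\<close> to a nonnegative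
  combination of those of \<open>s\<close> and \<open>t\<close>.
\<close>

lemma root_nonneg:
  assumes "g \<in> carrier C" "s \<in> X" "len g \<le> len (g \<otimes>\<^bsub>C\<^esub> gen s)"
  shows "rep g (unit_vec s) u \<ge> 0"
  using assms
proof (induction "len g" arbitrary: g s u rule: less_induct)
  case less
  note g = less.prems(1) and s = less.prems(2)
  show ?case
  proof (cases "g = \<one>\<^bsub>C\<^esub>")
    case True
    then show ?thesis by (simp add: rep_one unit_vec_def)
  next
    case False
    obtain w where w: "set w \<subseteq> X" "wprod w = g" "length w = len g"
      using reduced_word[OF g] .
    with False have "w \<noteq> []" by auto
    then obtain w' t where w': "w = w' @ [t]" by (cases w rule: rev_cases) auto
    have t: "t \<in> X" and w'X: "set w' \<subseteq> X" using w w' by auto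
    have g_eq: "g = wprod w' \<otimes>\<^bsub>C\<^esub> gen t" using w w' w'X t by (auto simp: wprod_append)
    have "s \<noteq> t"
    proof
      assume "s = t"
      then have "g \<otimes>\<^bsub>C\<^esub> gen s = wprod w'"
        using g_eq w'X t by (simp add: C.m_assoc gen_square)
      then show False using len_wprod_le[OF w'X] less.prems(3) w w' by simp
    qed
    have alt_X: "set (alt t s k) \<subseteq> X" "set (alt s t k) \<subseteq> X" for k
      using set_alt[of t s k] set_alt[of s t k] s t by auto
    define Q where "Q k \<longleftrightarrow> (\<exists>v\<in>carrier C. g = v \<otimes>\<^bsub>C\<^esub> wprod (alt t s k) \<and> len v + k \<le> len g)" for k
    have "Q 1"
      unfolding Q_def using g_eq w'X t len_wprod_le[OF w'X] w w'
      by (intro bexI[of _ "wprod w'"]) auto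
    moreover have Q_bound: "Q k \<Longrightarrow> k \<le> len g" for k by (auto simp: Q_def)
    ultimately have ex_k: "Q (GREATEST k. Q k)" and k_max: "\<And>j. Q j \<Longrightarrow> j \<le> (GREATEST k. Q k)"
      by (blast intro: GreatestI_nat Greatest_le_nat)+
    define k where "k = (GREATEST k. Q k)"
    have "k \<ge> 1" using k_max[OF \<open>Q 1\<close>] by (simp add: k_def)
    then obtain k' where k': "k = Suc k'" by (cases k) auto
    have not_Q: "\<not> Q (Suc k)" using k_max[of "Suc k"] by (auto simp: k_def)
    obtain v where v: "v \<in> carrier C" "g = v \<otimes>\<^bsub>C\<^esub> wprod (alt t s k)" "len v + k \<le> len g"
      using ex_k by (auto simp: k_def Q_def)
    have cancel: "(v \<otimes>\<^bsub>C\<^esub> gen y) \<otimes>\<^bsub>C\<^esub> (gen y \<otimes>\<^bsub>C\<^esub> h) = v \<otimes>\<^bsub>C\<^esub> h"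
      if "y \<in> X" "h \<in> carrier C" for y h
      using that v(1) by (simp add: C.m_assoc) (simp add: C.m_assoc[symmetric] gen_square)
    \<comment> \<open>\<open>z\<close> is the first letter of the alternating word, and \<open>y\<close> the letter that would extend it.\<close>
    define y z where "y = (if even k then t else s)" and "z = (if even k' then t else s)"
    have yz: "y \<in> X" "z \<in> X" "{y, z} = {s, t}" using s t k' by (auto simp: y_def z_def)
    have "len v \<le> len (v \<otimes>\<^bsub>C\<^esub> gen y)"
    proof (rule ccontr)
      assume "\<not> ?thesis"
      moreover have "g = (v \<otimes>\<^bsub>C\<^esub> gen y) \<otimes>\<^bsub>C\<^esub> wprod (alt t s (Suc k))"
        using v(2) cancel[OF yz(1)] alt_X by (simp add: y_def)
      ultimately have "Q (Suc k)"
        unfolding Q_def using v yz by (intro bexI[of _ "v \<otimes>\<^bsub>C\<^esub> gen y"]) auto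
      then show False using not_Q by simp
    qed
    moreover have "len v \<le> len (v \<otimes>\<^bsub>C\<^esub> gen z)"
    proof (rule ccontr)
      \<comment> \<open>Moving \<open>z\<close> from the alternating word into \<open>v\<close> would give a word for \<open>g\<close> of length below \<open>len g\<close>.\<close>
      assume "\<not> ?thesis"
      moreover have "g = (v \<otimes>\<^bsub>C\<^esub> gen z) \<otimes>\<^bsub>C\<^esub> wprod (alt t s k')"
      proof -
        have "wprod (alt t s k) = gen z \<otimes>\<^bsub>C\<^esub> wprod (alt t s k')" by (simp add: k' z_def)
        then show ?thesis
          using v(1,2) alt_X(1)[of k'] yz(2) by (simp add: C.m_assoc)
      qed
      ultimately show False
        using len_mult_wprod_le[of "v \<otimes>\<^bsub>C\<^esub> gen z" "alt t s k'"] v yz alt_X k' by simp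
    qed
    ultimately have len_st: "len v \<le> len (v \<otimes>\<^bsub>C\<^esub> gen s)" "len v \<le> len (v \<otimes>\<^bsub>C\<^esub> gen t)"
      using yz(3) by (metis doubleton_eq_iff)+
    have IH: "rep v (unit_vec s) u \<ge> 0" "rep v (unit_vec t) u \<ge> 0" for u
      using less.hyps[of v] v \<open>k \<ge> 1\<close> len_st s t by auto
    have k_lt: "k < m s t" if fin: "m s t \<noteq> 0"
    proof (rule ccontr)
      assume "\<not> k < m s t"
      then obtain j where j: "k = j + m s t" by (metis add.commute le_Suc_ex not_less)
      obtain p where p: "length p = j" "set p \<subseteq> {s, t}"
          "alt s t (j + Suc (m s t)) = p @ alt s t (Suc (m s t))"
        using alt_split by meson
      obtain q where q: "set q \<subseteq> X" "length q < m s t" "wprod q = wprod (alt s t (Suc (m s t)))"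
        using wprod_alt_shorter[OF s t fin] .
      have pX: "set p \<subseteq> X" using p(2) s t by auto
      have "wprod (alt t s k) \<otimes>\<^bsub>C\<^esub> gen s = wprod (alt t s k @ [s])"
        using alt_X s by (simp add: wprod_append)
      also have "\<dots> = wprod (p @ q)"
        using p(3) q pX alt_X by (simp add: alt_snoc j wprod_append del: alt.simps)
      finally have "g \<otimes>\<^bsub>C\<^esub> gen s = v \<otimes>\<^bsub>C\<^esub> wprod (p @ q)"
        using v alt_X s by (simp add: C.m_assoc)
      then have "len (g \<otimes>\<^bsub>C\<^esub> gen s) \<le> len v + (length p + length q)"
        using len_mult_wprod_le[of v "p @ q"] v pX q by simp
      then show False using less.prems(3) v(3) p(1) q(2) j by simp
    qed
    define a b where "a = dsin s t (if even k then Suc k else k)"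
      and "b = dsin s t (if even k then k else Suc k)"
    have ab: "a \<ge> 0" "b \<ge> 0"
      unfolding a_def b_def by (rule dsin_nonneg[OF s t \<open>s \<noteq> t\<close>]; use k_lt in force)+
    have "rep g (unit_vec s) = rep v (\<lambda>u. a * unit_vec s u + b * unit_vec t u)"
      using v alt_X by (simp add: rep_mult rep_wprod reflects_alt[OF s t \<open>s \<noteq> t\<close>] a_def b_def)
    then show ?thesis using IH ab v(1) by (simp add: rep_lincomb)
  qed
qed

text \<open>
  If \<open>g = g' s\<close> with \<open>g'\<close> shorter, then \<open>g\<close> maps the basis vector of \<open>s\<close> to the negative of a
  nonnegative vector.
\<close>

lemma rep_faithful:
  assumes g: "g \<in> carrier C"
    and fix_basis: "\<And>s u. s \<in> X \<Longrightarrow> u \<in> X \<Longrightarrow> rep g (unit_vec s) u = unit_vec s u"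
  shows "g = \<one>\<^bsub>C\<^esub>"
proof (rule ccontr)
  assume "g \<noteq> \<one>\<^bsub>C\<^esub>"
  obtain w where w: "set w \<subseteq> X" "wprod w = g" "length w = len g"
    using reduced_word[OF g] .
  with \<open>g \<noteq> \<one>\<^bsub>C\<^esub>\<close> have "w \<noteq> []" by auto
  then obtain w' s where w': "w = w' @ [s]" by (cases w rule: rev_cases) auto
  have s: "s \<in> X" and w'X: "set w' \<subseteq> X" using w w' by auto
  have g_eq: "g = wprod w' \<otimes>\<^bsub>C\<^esub> gen s" using w w' w'X s by (auto simp: wprod_append)
  have "len (wprod w') \<le> len (wprod w' \<otimes>\<^bsub>C\<^esub> gen s)"
    using len_wprod_le[OF w'X] w w' g_eq by simp
  then have "rep (wprod w') (unit_vec s) s \<ge> 0"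
    using root_nonneg w'X s by simp
  moreover have "rep g (unit_vec s) s = - rep (wprod w') (unit_vec s) s"
    using w'X s by (simp add: g_eq rep_mult rep_gen reflect_unit_vec_same rep_wprod reflects_uminus)
  ultimately show False using fix_basis[OF s s] by (simp add: unit_vec_def)
qed

end

lemma linear_group_if_embeds_in_coxeter_group:
  fixes X :: "'x set" and G :: "('g, 'b) monoid_scheme"
  assumes G: "group G" and "finite X" "coxeter_matrix X m"
    and \<Phi>: "\<Phi> \<in> hom G (presented_group X (coxeter_relators X m))"
    and inj: "\<And>g. g \<in> carrier G \<Longrightarrow> \<Phi> g = \<one>\<^bsub>presented_group X (coxeter_relators X m)\<^esub> \<Longrightarrow> g = \<one>\<^bsub>G\<^esub>"
  shows "linear_group G"
proof -
  interpret coxeter_data X m using assms(2,3) by unfold_locales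
  have \<Phi>: "\<Phi> \<in> hom G C" using \<Phi> by (simp add: C_def)
  note closed = hom_in_carrier[OF \<Phi>]
  show ?thesis
  proof (rule linear_group_if_faithful_action[OF G X_finite, where \<rho> = "\<lambda>g. rep (\<Phi> g)"])
    show "linear_on X (rep (\<Phi> g))" if "g \<in> carrier G" for g
      using closed[OF that] by (rule linear_on_rep)
    show "rep (\<Phi> (g \<otimes>\<^bsub>G\<^esub> h)) x = rep (\<Phi> g) (rep (\<Phi> h) x)"
      if "g \<in> carrier G" "h \<in> carrier G" for g h x
      using that closed by (simp add: hom_mult[OF \<Phi>] rep_mult)
    show "rep (\<Phi> \<one>\<^bsub>G\<^esub>) x = x" for x
      using hom_one[OF \<Phi> G C.is_group] by (simp add: rep_one)
    show "g = \<one>\<^bsub>G\<^esub>" if "g \<in> carrier G"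
      "\<And>s u. s \<in> X \<Longrightarrow> u \<in> X \<Longrightarrow> rep (\<Phi> g) (unit_vec s) u = unit_vec s u" for g
      using rep_faithful[OF closed[OF that(1)] that(2)] inj[OF that(1)] by (simp add: C_def)
  qed
qed

section \<open>Graph products of pairs of subgroups\<close>

text \<open>
  The setting of the injectivity argument, which is about arbitrary groups \<open>W v\<close> with two subgroups
  \<open>P v\<close> and \<open>H v\<close>.
\<close>

locale subgroup_pairs =
  fixes V :: "'v set" and E :: "('v \<times> 'v) set"
    and W :: "'v \<Rightarrow> 'a monoid" and P H :: "'v \<Rightarrow> 'a set"
  assumes V_finite: "finite V" and graph: "simple_graph_on V E"
    and W_group: "v \<in> V \<Longrightarrow> group (W v)"
    and P_subgroup: "v \<in> V \<Longrightarrow> subgroup (P v) (W v)"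
    and H_subgroup: "v \<in> V \<Longrightarrow> subgroup (H v) (W v)"
begin

subsection \<open>The local groups and their images\<close>

abbreviation HW :: "'v \<Rightarrow> 'a monoid" where
  "HW v \<equiv> (W v)\<lparr>carrier := H v\<rparr>"

abbreviation local_group :: "'v set \<Rightarrow> ('v \<Rightarrow> 'a) monoid" where
  "local_group \<equiv> pair_product V HW (\<lambda>v. H v \<inter> P v)"

abbreviation cliques :: "'v set set" where
  "cliques \<equiv> complete_subgraphs V E"

definition GP :: "('v set \<times> ('v \<Rightarrow> 'a)) word set monoid" where
  "GP = graph_product_of_pairs V E HW (\<lambda>v. H v \<inter> P v)"

definition \<iota> :: "'v set \<Rightarrow> ('v \<Rightarrow> 'a) \<Rightarrow> ('v set \<times> ('v \<Rightarrow> 'a)) word set" where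
  "\<iota> = colimit_map cliques (\<subseteq>) local_group (\<lambda>S T g. g)"

definition single :: "'v \<Rightarrow> 'a \<Rightarrow> 'v \<Rightarrow> 'a" where
  "single v x = (\<lambda>u\<in>V. if u = v then x else \<one>\<^bsub>W u\<^esub>)"

definition emb :: "'v \<Rightarrow> 'a \<Rightarrow> ('v set \<times> ('v \<Rightarrow> 'a)) word set" where
  "emb v x = \<iota> {v} (single v x)"

sublocale GP: group GP
  unfolding GP_def graph_product_of_pairs_def by (rule group_group_colimit)

lemma local_group_carrier:
  "carrier (local_group S) = (\<Pi>\<^sub>E v\<in>V. if v \<in> S then H v else H v \<inter> P v)"
  unfolding pair_product_def carrier_product_group by (rule PiE_cong) simp

lemma local_group_mult: "g \<otimes>\<^bsub>local_group S\<^esub> h = (\<lambda>v\<in>V. g v \<otimes>\<^bsub>W v\<^esub> h v)"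
  by (auto simp: pair_product_def restrict_def)

lemma local_group_one: "\<one>\<^bsub>local_group S\<^esub> = (\<lambda>v\<in>V. \<one>\<^bsub>W v\<^esub>)"
  by (auto simp: pair_product_def restrict_def)

lemma H_mem: "v \<in> V \<Longrightarrow> x \<in> H v \<Longrightarrow> x \<in> carrier (W v)"
  using H_subgroup subgroup.subset by blast

lemma P_mem: "v \<in> V \<Longrightarrow> x \<in> P v \<Longrightarrow> x \<in> carrier (W v)"
  using P_subgroup subgroup.subset by blast

lemma group_local_group: "group (local_group S)"
proof -
  have "group (if v \<in> S then HW v else HW v\<lparr>carrier := H v \<inter> P v\<rparr>)" if v: "v \<in> V" for v
  proof -
    interpret Wv: group "W v" using W_group[OF v] .
    have "subgroup (H v \<inter> P v) (W v)"
      using H_subgroup[OF v] P_subgroup[OF v] by (rule Wv.subgroups_Inter_pair)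
    then show ?thesis using H_subgroup[OF v] by (auto intro: Wv.subgroup_imp_group)
  qed
  then show ?thesis unfolding pair_product_def by (intro product_group) auto
qed

lemma clique_subsets: "{} \<in> cliques" "v \<in> V \<Longrightarrow> {v} \<in> cliques"
  "(v, w) \<in> E \<Longrightarrow> {v, w} \<in> cliques"
  using graph by (auto simp: complete_subgraphs_def simple_graph_on_def dest: symD)

lemma \<iota>_hom: "S \<in> cliques \<Longrightarrow> \<iota> S \<in> hom (local_group S) GP"
  unfolding \<iota>_def GP_def graph_product_of_pairs_def by (intro colimit_map_hom group_local_group)

lemma \<iota>_closed: "S \<in> cliques \<Longrightarrow> g \<in> carrier (local_group S) \<Longrightarrow> \<iota> S g \<in> carrier GP"
  using hom_in_carrier[OF \<iota>_hom] .

lemma \<iota>_mult: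
  "S \<in> cliques \<Longrightarrow> g \<in> carrier (local_group S) \<Longrightarrow> h \<in> carrier (local_group S) \<Longrightarrow>
    \<iota> S (\<lambda>v\<in>V. g v \<otimes>\<^bsub>W v\<^esub> h v) = \<iota> S g \<otimes>\<^bsub>GP\<^esub> \<iota> S h"
  using hom_mult[OF \<iota>_hom] by (simp add: local_group_mult)

lemma local_group_mono: "S \<subseteq> T \<Longrightarrow> carrier (local_group S) \<subseteq> carrier (local_group T)"
  unfolding local_group_carrier by (rule PiE_mono) auto

lemma \<iota>_mono:
  assumes "S \<in> cliques" "T \<in> cliques" "S \<subseteq> T" "g \<in> carrier (local_group S)"
  shows "\<iota> T g = \<iota> S g"
  unfolding \<iota>_def
  by (rule colimit_map_compat) (use assms local_group_mono[of S T] in auto)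

lemma GP_induct [consumes 1, case_names one mult]:
  assumes "\<gamma> \<in> carrier GP"
    and one: "Q \<one>\<^bsub>GP\<^esub>"
    and step: "\<And>S g \<gamma>. S \<in> cliques \<Longrightarrow> g \<in> carrier (local_group S) \<Longrightarrow> \<gamma> \<in> carrier GP \<Longrightarrow>
      Q \<gamma> \<Longrightarrow> Q (\<iota> S g \<otimes>\<^bsub>GP\<^esub> \<gamma>)"
  shows "Q \<gamma>"
proof -
  let ?X = "colimit_gens cliques local_group"
  let ?R = "colimit_relators cliques (\<subseteq>) local_group (\<lambda>S T g. g)"
  have GP_eq: "GP = presented_group ?X ?R"
    by (simp add: GP_def graph_product_of_pairs_def group_colimit_def)
  have gen: "presented_gen ?X ?R (S, g) = \<iota> S g" for S g
    by (simp add: \<iota>_def colimit_map_def)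
  have "Q (eval_word GP (presented_gen ?X ?R) u)" if "u \<in> words ?X" for u
    using that
  proof (induction u)
    case Nil
    show ?case using one by simp
  next
    case (Cons p u)
    obtain S g b where p: "p = ((S, g), b)" by (metis surj_pair)
    have S: "S \<in> cliques" and g: "g \<in> carrier (local_group S)"
      using Cons.prems p by (auto simp: colimit_gens_def)
    have u: "eval_word GP (presented_gen ?X ?R) u \<in> carrier GP"
      using Cons.prems by (simp add: GP_eq eval_word_presented_gen presented_group_carrierI)
    interpret L: group "local_group S" by (rule group_local_group)
    interpret \<iota>: group_hom "local_group S" GP "\<iota> S"
      by unfold_locales (rule \<iota>_hom[OF S])
    obtain g' where g': "g' \<in> carrier (local_group S)"
      "(if b then \<iota> S g else inv\<^bsub>GP\<^esub> \<iota> S g) = \<iota> S g'"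
      using g by (cases b) (auto simp: \<iota>.hom_inv[symmetric] simp del: \<iota>.hom_inv)
    have "Q (eval_word GP (presented_gen ?X ?R) u)" using Cons by simp
    moreover have "eval_word GP (presented_gen ?X ?R) (p # u)
        = \<iota> S g' \<otimes>\<^bsub>GP\<^esub> eval_word GP (presented_gen ?X ?R) u"
      by (simp only: eval_word.simps p fst_conv snd_conv gen g'(2))
    ultimately show ?case using step[OF S g'(1) u] by simp
  qed
  moreover obtain u where u: "u \<in> words ?X" "\<gamma> = word_cong ?X ?R `` {u}"
    using assms(1) unfolding GP_eq by (elim presented_group_carrierE)
  ultimately have "Q (eval_word GP (presented_gen ?X ?R) u)" by blast
  moreover have "eval_word GP (presented_gen ?X ?R) u = \<gamma>"
    using u unfolding GP_eq by (simp only: eval_word_presented_gen)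
  ultimately show ?thesis by (simp only:)
qed

lemma single_mem:
  assumes "v \<in> V" "x \<in> H v" "v \<in> S \<or> x \<in> P v"
  shows "single v x \<in> carrier (local_group S)"
proof -
  have "\<one>\<^bsub>W u\<^esub> \<in> H u \<inter> P u" if "u \<in> V" for u
    using subgroup.one_closed[OF H_subgroup[OF that]] subgroup.one_closed[OF P_subgroup[OF that]]
    by simp
  then show ?thesis using assms by (auto simp: local_group_carrier single_def PiE_iff)
qed

text \<open>
  An element of \<open>H v \<inter> P v\<close> has the same image whether or not \<open>v\<close> belongs to the clique, as it
  already comes from the empty clique.
\<close>

lemma \<iota>_single:
  assumes S: "S \<in> cliques" and v: "v \<in> V" and x: "x \<in> H v" "v \<in> S \<or> x \<in> P v"
  shows "\<iota> S (single v x) = emb v x"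
proof (cases "v \<in> S")
  case True
  then show ?thesis
    unfolding emb_def using S v x by (intro \<iota>_mono clique_subsets single_mem) auto
next
  case False
  with v x have "single v x \<in> carrier (local_group {})" by (intro single_mem) auto
  then have "\<iota> T (single v x) = \<iota> {} (single v x)" if "T \<in> cliques" for T
    using that clique_subsets(1) by (intro \<iota>_mono) auto
  from this[OF S] this[OF clique_subsets(2)[OF v]] show ?thesis by (simp add: emb_def)
qed

lemma emb_closed [simp]: "v \<in> V \<Longrightarrow> x \<in> H v \<Longrightarrow> emb v x \<in> carrier GP"
  unfolding emb_def by (intro \<iota>_closed clique_subsets single_mem) auto

lemma emb_mult:
  assumes v: "v \<in> V" and x: "x \<in> H v" and y: "y \<in> H v"
  shows "emb v (x \<otimes>\<^bsub>W v\<^esub> y) = emb v x \<otimes>\<^bsub>GP\<^esub> emb v y"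
proof -
  have "\<one>\<^bsub>W u\<^esub> \<otimes>\<^bsub>W u\<^esub> \<one>\<^bsub>W u\<^esub> = \<one>\<^bsub>W u\<^esub>" if "u \<in> V" for u
    using W_group[OF that] by (simp add: group.is_monoid)
  then have "single v (x \<otimes>\<^bsub>W v\<^esub> y) = (\<lambda>u\<in>V. single v x u \<otimes>\<^bsub>W u\<^esub> single v y u)"
    by (auto simp: single_def restrict_def fun_eq_iff)
  then show ?thesis
    unfolding emb_def using v x y by (simp add: \<iota>_mult clique_subsets single_mem)
qed

lemma emb_one: "v \<in> V \<Longrightarrow> emb v \<one>\<^bsub>W v\<^esub> = \<one>\<^bsub>GP\<^esub>"
proof -
  assume v: "v \<in> V"
  have one: "\<one>\<^bsub>W v\<^esub> \<in> H v" using subgroup.one_closed[OF H_subgroup[OF v]] .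
  have "emb v \<one>\<^bsub>W v\<^esub> \<otimes>\<^bsub>GP\<^esub> emb v \<one>\<^bsub>W v\<^esub> = emb v \<one>\<^bsub>W v\<^esub>"
    using emb_mult[OF v one one] W_group[OF v] by (simp add: group.is_monoid)
  then show ?thesis using GP.r_cancel_one'[of "emb v \<one>\<^bsub>W v\<^esub>" "emb v \<one>\<^bsub>W v\<^esub>"] emb_closed[OF v one] by simp
qed

lemma emb_commute:
  assumes vw: "(v, w) \<in> E" "v \<noteq> w" and x: "x \<in> H v" and y: "y \<in> H w"
  shows "emb v x \<otimes>\<^bsub>GP\<^esub> emb w y = emb w y \<otimes>\<^bsub>GP\<^esub> emb v x"
proof -
  have v: "v \<in> V" and w: "w \<in> V" using vw graph by (auto simp: simple_graph_on_def)
  have S: "{v, w} \<in> cliques" using clique_subsets(3)[OF vw(1)] .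
  have "(\<lambda>u\<in>V. single v x u \<otimes>\<^bsub>W u\<^esub> single w y u) = (\<lambda>u\<in>V. single w y u \<otimes>\<^bsub>W u\<^esub> single v x u)"
    using vw(2) H_mem[OF v x] H_mem[OF w y] W_group
    by (auto simp: single_def restrict_def fun_eq_iff group.is_monoid)
  moreover have "emb v x = \<iota> {v, w} (single v x)" "emb w y = \<iota> {v, w} (single w y)"
    using S v w x y by (simp_all add: \<iota>_single)
  ultimately show ?thesis
    using \<iota>_mult[OF S, of "single v x" "single w y"] \<iota>_mult[OF S, of "single w y" "single v x"] v w x y
    by (simp add: single_mem)
qed

lemma \<iota>_eq_prod_emb:
  assumes S: "S \<in> cliques" and g: "g \<in> carrier (local_group S)" and "distinct vs" "set vs = V"
  shows "\<iota> S g = foldr (\<lambda>v a. emb v (g v) \<otimes>\<^bsub>GP\<^esub> a) vs \<one>\<^bsub>GP\<^esub>"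
proof -
  let ?part = "\<lambda>us. (\<lambda>v\<in>V. if v \<in> set us then g v else \<one>\<^bsub>W v\<^esub>)"
  have gv: "g v \<in> H v" "v \<in> S \<or> g v \<in> P v" if "v \<in> V" for v
    using g that by (auto simp: local_group_carrier PiE_iff split: if_splits)
  have one: "\<one>\<^bsub>W u\<^esub> \<in> H u \<inter> P u" if "u \<in> V" for u
    using subgroup.one_closed[OF H_subgroup[OF that]] subgroup.one_closed[OF P_subgroup[OF that]]
    by simp
  have part: "?part us \<in> carrier (local_group S)" for us
    using gv one by (auto simp: local_group_carrier PiE_iff)
  have "\<iota> S (?part us) = foldr (\<lambda>v a. emb v (g v) \<otimes>\<^bsub>GP\<^esub> a) us \<one>\<^bsub>GP\<^esub>"
    if "distinct us" "set us \<subseteq> V" for us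
    using that
  proof (induction us)
    case Nil
    then show ?case
      using hom_one[OF \<iota>_hom[OF S] group_local_group GP.is_group] by (simp add: local_group_one restrict_def)
  next
    case (Cons u us)
    then have u: "u \<in> V" by simp
    have "?part (u # us) = (\<lambda>v\<in>V. single u (g u) v \<otimes>\<^bsub>W v\<^esub> ?part us v)"
      using Cons.prems H_mem gv(1) W_group
      by (auto simp: single_def fun_eq_iff restrict_def group.is_monoid)
    then have "\<iota> S (?part (u # us)) = emb u (g u) \<otimes>\<^bsub>GP\<^esub> \<iota> S (?part us)"
      using \<iota>_mult[OF S single_mem[OF u gv[OF u]] part] \<iota>_single[OF S u gv[OF u]] by simp
    then show ?case using Cons by (simp add: restrict_def)
  qed
  from this[of vs] have "\<iota> S (?part vs) = foldr (\<lambda>v a. emb v (g v) \<otimes>\<^bsub>GP\<^esub> a) vs \<one>\<^bsub>GP\<^esub>"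
    using assms by simp
  moreover have "?part vs = g"
    using g assms(4) by (auto simp: local_group_carrier PiE_iff extensional_def fun_eq_iff)
  ultimately show ?thesis by simp
qed

subsection \<open>Coset representatives\<close>

text \<open>
  The value on a coset that does not meet \<open>H v\<close> is arbitrary in \<open>H v\<close>; it only has to be the same for
  the whole coset.
\<close>

definition \<sigma> :: "'v \<Rightarrow> 'a \<Rightarrow> 'a" where
  "\<sigma> v x = (if H v \<inter> (P v #>\<^bsub>W v\<^esub> x) = {} then \<one>\<^bsub>W v\<^esub> else SOME h. h \<in> H v \<inter> (P v #>\<^bsub>W v\<^esub> x))"

lemma \<sigma>_mem:
  assumes "v \<in> V"
  shows "\<sigma> v x \<in> H v"
proof (cases "H v \<inter> (P v #>\<^bsub>W v\<^esub> x) = {}")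
  case True
  then show ?thesis using subgroup.one_closed[OF H_subgroup[OF assms]] by (simp add: \<sigma>_def)
next
  case False
  then have "\<exists>h. h \<in> H v \<inter> (P v #>\<^bsub>W v\<^esub> x)" by blast
  from someI_ex[OF this] False show ?thesis by (simp add: \<sigma>_def)
qed

lemma \<sigma>_P_invariant:
  assumes v: "v \<in> V" and p: "p \<in> P v" and x: "x \<in> carrier (W v)"
  shows "\<sigma> v (p \<otimes>\<^bsub>W v\<^esub> x) = \<sigma> v x"
proof -
  interpret Wv: group "W v" using W_group[OF v] .
  interpret Pv: subgroup "P v" "W v" using P_subgroup[OF v] .
  have "P v #>\<^bsub>W v\<^esub> (p \<otimes>\<^bsub>W v\<^esub> x) = P v #>\<^bsub>W v\<^esub> x"
    using Wv.coset_mult_assoc[OF Pv.subset P_mem[OF v p] x] Wv.coset_join2[OF P_mem[OF v p] P_subgroup[OF v] p]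
    by simp
  then show ?thesis by (simp add: \<sigma>_def)
qed

definition defect :: "'v \<Rightarrow> 'a \<Rightarrow> 'a" where
  "defect v x = x \<otimes>\<^bsub>W v\<^esub> inv\<^bsub>W v\<^esub> \<sigma> v x"

lemma defect_mem:
  assumes v: "v \<in> V" and x: "x \<in> H v"
  shows "defect v x \<in> H v \<inter> P v"
proof
  interpret Wv: group "W v" using W_group[OF v] .
  interpret Pv: subgroup "P v" "W v" using P_subgroup[OF v] .
  interpret Hv: subgroup "H v" "W v" using H_subgroup[OF v] .
  have xW: "x \<in> carrier (W v)" using H_mem[OF v x] .
  show "defect v x \<in> H v" using x \<sigma>_mem[OF v] by (simp add: defect_def)
  have "x \<in> H v \<inter> (P v #>\<^bsub>W v\<^esub> x)" using x xW Wv.rcos_self[OF _ P_subgroup[OF v]] by simp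
  then have "\<sigma> v x = (SOME h. h \<in> H v \<inter> (P v #>\<^bsub>W v\<^esub> x))" by (auto simp: \<sigma>_def)
  then have "\<sigma> v x \<in> P v #>\<^bsub>W v\<^esub> x" using someI[of "\<lambda>h. h \<in> H v \<inter> (P v #>\<^bsub>W v\<^esub> x)" x] \<open>x \<in> H v \<inter> _\<close> by simp
  then obtain p where p: "p \<in> P v" "\<sigma> v x = p \<otimes>\<^bsub>W v\<^esub> x" by (auto simp: r_coset_def)
  have "defect v x = inv\<^bsub>W v\<^esub> p"
    using p xW by (simp add: defect_def Wv.inv_mult_group Wv.m_assoc[symmetric])
  then show "defect v x \<in> P v" using p by simp
qed

subsection \<open>Action on coordinates and the graph product\<close>

definition \<Omega> :: "(('v \<Rightarrow> 'a) \<times> ('v set \<times> ('v \<Rightarrow> 'a)) word set) set" where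
  "\<Omega> = (\<Pi>\<^sub>E v\<in>V. carrier (W v)) \<times> carrier GP"

text \<open>
  This is a coboundary, hence a cocycle (\<open>shift_mult\<close>), with values in \<open>H v\<close> although \<open>k\<close> and \<open>x\<close>
  range over the larger group \<open>W v\<close>.
\<close>

definition shift :: "'v \<Rightarrow> 'a \<Rightarrow> 'a \<Rightarrow> 'a" where
  "shift v k x = \<sigma> v (k \<otimes>\<^bsub>W v\<^esub> x) \<otimes>\<^bsub>W v\<^esub> inv\<^bsub>W v\<^esub> \<sigma> v x"

definition act :: "'v \<Rightarrow> 'a \<Rightarrow>
    ('v \<Rightarrow> 'a) \<times> ('v set \<times> ('v \<Rightarrow> 'a)) word set \<Rightarrow> ('v \<Rightarrow> 'a) \<times> ('v set \<times> ('v \<Rightarrow> 'a)) word set" where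
  "act v k = (\<lambda>(g, a)\<in>\<Omega>. (g(v := k \<otimes>\<^bsub>W v\<^esub> g v), emb v (shift v k (g v)) \<otimes>\<^bsub>GP\<^esub> a))"

lemma shift_mem: "v \<in> V \<Longrightarrow> shift v k x \<in> H v"
proof -
  assume v: "v \<in> V"
  interpret Wv: group "W v" using W_group[OF v] .
  interpret Hv: subgroup "H v" "W v" using H_subgroup[OF v] .
  show ?thesis using \<sigma>_mem[OF v] by (simp add: shift_def)
qed

lemma shift_mult:
  assumes v: "v \<in> V" and k: "k \<in> carrier (W v)" and l: "l \<in> carrier (W v)" and x: "x \<in> carrier (W v)"
  shows "shift v (k \<otimes>\<^bsub>W v\<^esub> l) x = shift v k (l \<otimes>\<^bsub>W v\<^esub> x) \<otimes>\<^bsub>W v\<^esub> shift v l x"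
proof -
  interpret Wv: group "W v" using W_group[OF v] .
  have \<sigma>: "\<sigma> v y \<in> carrier (W v)" for y using \<sigma>_mem[OF v] H_mem[OF v] by blast
  have "a \<otimes>\<^bsub>W v\<^esub> inv\<^bsub>W v\<^esub> b \<otimes>\<^bsub>W v\<^esub> (b \<otimes>\<^bsub>W v\<^esub> c) = a \<otimes>\<^bsub>W v\<^esub> c"
    if "a \<in> carrier (W v)" "b \<in> carrier (W v)" "c \<in> carrier (W v)" for a b c
    using that by (simp add: Wv.m_assoc Wv.inv_solve_left')
  then show ?thesis using k l x \<sigma> by (simp add: shift_def Wv.m_assoc)
qed

lemma shift_P: "v \<in> V \<Longrightarrow> k \<in> P v \<Longrightarrow> x \<in> carrier (W v) \<Longrightarrow> shift v k x = \<one>\<^bsub>W v\<^esub>"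
  using group.r_inv[OF W_group H_mem[OF _ \<sigma>_mem]] by (simp add: shift_def \<sigma>_P_invariant)

lemma act_mem:
  assumes v: "v \<in> V" and k: "k \<in> carrier (W v)" and \<omega>: "\<omega> \<in> \<Omega>"
  shows "act v k \<omega> \<in> \<Omega>"
proof -
  interpret Wv: group "W v" using W_group[OF v] .
  obtain g a where \<omega>': "\<omega> = (g, a)" by force
  have "k \<otimes>\<^bsub>W v\<^esub> g v \<in> carrier (W v)" using \<omega> v k by (auto simp: \<omega>' \<Omega>_def)
  then show ?thesis
    using \<omega> v shift_mem[OF v] by (auto simp: \<omega>' act_def \<Omega>_def PiE_iff extensional_def)
qed

lemma act_mult:
  assumes v: "v \<in> V" and k: "k \<in> carrier (W v)" and l: "l \<in> carrier (W v)" and \<omega>: "\<omega> \<in> \<Omega>"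
  shows "act v (k \<otimes>\<^bsub>W v\<^esub> l) \<omega> = act v k (act v l \<omega>)"
proof -
  interpret Wv: group "W v" using W_group[OF v] .
  obtain g a where \<omega>': "\<omega> = (g, a)" by force
  have gv: "g v \<in> carrier (W v)" and a: "a \<in> carrier GP" using \<omega> v by (auto simp: \<omega>' \<Omega>_def)
  have "act v k (act v l \<omega>) = (g(v := k \<otimes>\<^bsub>W v\<^esub> (l \<otimes>\<^bsub>W v\<^esub> g v)),
      emb v (shift v k (l \<otimes>\<^bsub>W v\<^esub> g v)) \<otimes>\<^bsub>GP\<^esub> (emb v (shift v l (g v)) \<otimes>\<^bsub>GP\<^esub> a))"
    using act_mem[OF v l \<omega>] \<omega> by (simp add: act_def \<omega>')
  also have "\<dots> = act v (k \<otimes>\<^bsub>W v\<^esub> l) \<omega>"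
    using \<omega> gv a k l shift_mem[OF v]
    by (simp add: act_def \<omega>' shift_mult[OF v] emb_mult[OF v] GP.m_assoc v Wv.m_assoc)
  finally show ?thesis by simp
qed

lemma act_one:
  assumes v: "v \<in> V" and \<omega>: "\<omega> \<in> \<Omega>"
  shows "act v \<one>\<^bsub>W v\<^esub> \<omega> = \<omega>"
proof -
  interpret Wv: group "W v" using W_group[OF v] .
  have "\<one>\<^bsub>W v\<^esub> \<in> P v" using subgroup.one_closed[OF P_subgroup[OF v]] .
  moreover obtain g a where \<omega>': "\<omega> = (g, a)" by force
  moreover have "g v \<in> carrier (W v)" "a \<in> carrier GP" using \<omega> v by (auto simp: \<omega>' \<Omega>_def)
  ultimately show ?thesis
    using \<omega> v by (simp add: act_def shift_P emb_one)
qed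

lemma act_Bij:
  assumes v: "v \<in> V" and k: "k \<in> carrier (W v)"
  shows "act v k \<in> Bij \<Omega>"
proof -
  interpret Wv: group "W v" using W_group[OF v] .
  have "bij_betw (act v k) \<Omega> \<Omega>"
  proof (rule bij_betwI[where g = "act v (inv\<^bsub>W v\<^esub> k)"])
    show "act v (inv\<^bsub>W v\<^esub> k) (act v k \<omega>) = \<omega>" "act v k (act v (inv\<^bsub>W v\<^esub> k) \<omega>) = \<omega>" if "\<omega> \<in> \<Omega>" for \<omega>
      using that k v by (simp_all add: act_mult[symmetric] act_one)
  qed (use act_mem v k in auto)
  then show ?thesis by (simp add: Bij_def act_def)
qed

lemma act_hom: "v \<in> V \<Longrightarrow> act v \<in> hom (W v) (BijGroup \<Omega>)"
proof (rule homI)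
  interpret B: group "BijGroup \<Omega>" by (rule group_BijGroup)
  assume v: "v \<in> V"
  interpret Wv: group "W v" using W_group[OF v] .
  show closed: "act v k \<in> carrier (BijGroup \<Omega>)" if "k \<in> carrier (W v)" for k
    using act_Bij[OF v that] by (simp add: BijGroup_def)
  show "act v (k \<otimes>\<^bsub>W v\<^esub> l) = act v k \<otimes>\<^bsub>BijGroup \<Omega>\<^esub> act v l"
    if "k \<in> carrier (W v)" "l \<in> carrier (W v)" for k l
    by (rule BijGroup_eqI[where A = \<Omega>]) (use that v in \<open>simp_all add: closed mult_BijGroup_apply act_mult\<close>)
qed

text \<open>
  The two actions change different coordinates, and each multiplies by a factor that depends only on
  its own coordinate. These factors commute: for adjacent vertices by the relations of the graph
  product, and otherwise because one of them is trivial.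
\<close>

lemma act_commute:
  assumes v: "v \<in> V" and w: "w \<in> V" and "v \<noteq> w"
    and k: "k \<in> carrier (W v)" and l: "l \<in> carrier (W w)" and adm: "(v, w) \<in> E \<or> k \<in> P v \<or> l \<in> P w"
  shows "act v k \<otimes>\<^bsub>BijGroup \<Omega>\<^esub> act w l = act w l \<otimes>\<^bsub>BijGroup \<Omega>\<^esub> act v k"
proof -
  interpret B: group "BijGroup \<Omega>" by (rule group_BijGroup)
  have mem: "act v k \<in> carrier (BijGroup \<Omega>)" "act w l \<in> carrier (BijGroup \<Omega>)"
    using act_Bij v w k l by (auto simp: BijGroup_def)
  show ?thesis
  proof (rule BijGroup_eqI)
    fix \<omega> assume \<omega>: "\<omega> \<in> \<Omega>"
    obtain g a where \<omega>': "\<omega> = (g, a)" by force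
    have gv: "g v \<in> carrier (W v)" and gw: "g w \<in> carrier (W w)" and a: "a \<in> carrier GP"
      using \<omega> v w by (auto simp: \<omega>' \<Omega>_def)
    define p q where "p = emb v (shift v k (g v))" and "q = emb w (shift w l (g w))"
    have pq: "p \<in> carrier GP" "q \<in> carrier GP"
      using v w shift_mem by (auto simp: p_def q_def)
    have "p \<otimes>\<^bsub>GP\<^esub> q = q \<otimes>\<^bsub>GP\<^esub> p"
      using adm
    proof (elim disjE)
      assume "(v, w) \<in> E"
      then show ?thesis
        unfolding p_def q_def using \<open>v \<noteq> w\<close> v w by (intro emb_commute shift_mem)
    next
      assume "k \<in> P v"
      then have "p = \<one>\<^bsub>GP\<^esub>" using v gv by (simp add: p_def shift_P emb_one)
      then show ?thesis using pq by simp
    next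
      assume "l \<in> P w"
      then have "q = \<one>\<^bsub>GP\<^esub>" using w gw by (simp add: q_def shift_P emb_one)
      then show ?thesis using pq by simp
    qed
    then have "p \<otimes>\<^bsub>GP\<^esub> (q \<otimes>\<^bsub>GP\<^esub> a) = q \<otimes>\<^bsub>GP\<^esub> (p \<otimes>\<^bsub>GP\<^esub> a)"
      using pq a by (simp add: GP.m_assoc[symmetric])
    then have "act v k (act w l \<omega>) = act w l (act v k \<omega>)"
      using act_mem[OF v k \<omega>] act_mem[OF w l \<omega>] \<omega> \<open>v \<noteq> w\<close>
      by (simp add: \<omega>' act_def p_def q_def fun_upd_twist)
    then show "(act v k \<otimes>\<^bsub>BijGroup \<Omega>\<^esub> act w l) \<omega> = (act w l \<otimes>\<^bsub>BijGroup \<Omega>\<^esub> act v k) \<omega>"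
      using mem \<omega> by (simp add: mult_BijGroup_apply)
  qed (use mem in auto)
qed

definition \<Omega>H :: "(('v \<Rightarrow> 'a) \<times> ('v set \<times> ('v \<Rightarrow> 'a)) word set) set" where
  "\<Omega>H = (\<Pi>\<^sub>E v\<in>V. H v) \<times> carrier GP"

text \<open>
  On the invariant subset \<open>\<Omega>H\<close> the first factor is defined, because all coordinates of
  \<open>g \<sigma>(g)\<^sup>-\<^sup>1\<close> lie in \<open>H v \<inter> P v\<close>.
\<close>

definition val :: "('v \<Rightarrow> 'a) \<times> ('v set \<times> ('v \<Rightarrow> 'a)) word set \<Rightarrow> ('v set \<times> ('v \<Rightarrow> 'a)) word set" where
  "val = (\<lambda>(g, a). \<iota> {} (\<lambda>v\<in>V. defect v (g v)) \<otimes>\<^bsub>GP\<^esub> a)"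

lemma \<Omega>H_subset: "\<Omega>H \<subseteq> \<Omega>"
  using H_mem by (auto simp: \<Omega>H_def \<Omega>_def PiE_iff)

lemma defects_mem: "g \<in> (\<Pi>\<^sub>E v\<in>V. H v) \<Longrightarrow> (\<lambda>v\<in>V. defect v (g v)) \<in> carrier (local_group S)"
  using defect_mem by (auto simp: local_group_carrier PiE_iff)

lemma val_closed: "\<omega> \<in> \<Omega>H \<Longrightarrow> val \<omega> \<in> carrier GP"
  using \<iota>_closed[OF clique_subsets(1) defects_mem] by (auto simp: val_def \<Omega>H_def)

lemma act_\<Omega>H:
  assumes v: "v \<in> V" and k: "k \<in> H v" and \<omega>: "\<omega> \<in> \<Omega>H"
  shows "act v k \<omega> \<in> \<Omega>H"
proof -
  interpret Hv: subgroup "H v" "W v" using H_subgroup[OF v] .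
  obtain g a where \<omega>': "\<omega> = (g, a)" by force
  have "k \<otimes>\<^bsub>W v\<^esub> g v \<in> H v" using \<omega> v k by (auto simp: \<omega>' \<Omega>H_def)
  moreover have "\<omega> \<in> \<Omega>" using \<omega> \<Omega>H_subset by blast
  ultimately show ?thesis
    using \<omega> v shift_mem[OF v]
    by (auto simp: \<omega>' act_def \<Omega>H_def PiE_iff extensional_def)
qed

text \<open>
  Everything except \<open>a\<close> takes place in the group of the clique \<open>{v}\<close>. In the coordinate \<open>v\<close> the factor
  \<open>\<sigma>(k x)\<^sup>-\<^sup>1\<close> of the new defect cancels against the shift \<open>\<sigma>(k x) \<sigma>(x)\<^sup>-\<^sup>1\<close>, and what remains is
  \<open>k\<close> times the old defect; in the other coordinates nothing changes.
\<close>

lemma val_act: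
  assumes v: "v \<in> V" and k: "k \<in> H v" and \<omega>: "\<omega> \<in> \<Omega>H"
  shows "val (act v k \<omega>) = emb v k \<otimes>\<^bsub>GP\<^esub> val \<omega>"
proof -
  interpret Wv: group "W v" using W_group[OF v] .
  interpret Hv: subgroup "H v" "W v" using H_subgroup[OF v] .
  obtain g a where \<omega>': "\<omega> = (g, a)" by force
  have g: "g \<in> (\<Pi>\<^sub>E v\<in>V. H v)" and a: "a \<in> carrier GP" and gv: "g v \<in> H v"
    using \<omega> v by (auto simp: \<omega>' \<Omega>H_def)
  have \<omega>\<Omega>: "\<omega> \<in> \<Omega>" using \<omega> \<Omega>H_subset by blast
  define g' where "g' = g(v := k \<otimes>\<^bsub>W v\<^esub> g v)"
  have g': "g' \<in> (\<Pi>\<^sub>E v\<in>V. H v)"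
    using g gv v k by (auto simp: g'_def PiE_iff extensional_def)
  define d d' where "d = (\<lambda>u\<in>V. defect u (g u))" and "d' = (\<lambda>u\<in>V. defect u (g' u))"
  have d: "d \<in> carrier (local_group S)" "d' \<in> carrier (local_group S)" for S
    unfolding d_def d'_def by (rule defects_mem[OF g], rule defects_mem[OF g'])
  have clique: "{} \<in> cliques" "{v} \<in> cliques" using clique_subsets v by auto
  have \<iota>d: "\<iota> {} d = \<iota> {v} d" "\<iota> {} d' = \<iota> {v} d'"
    using d clique \<iota>_mono[of "{}" "{v}"] by simp_all
  have sm: "single v x \<in> carrier (local_group {v})" if "x \<in> H v" for x
    using that v by (intro single_mem) auto
  have dW: "defect u (g u) \<in> carrier (W u)" if "u \<in> V" for u
    using that g defect_mem[OF that, of "g u"] H_mem[OF that] by auto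
  have \<sigma>: "\<sigma> v y \<in> carrier (W v)" for y using \<sigma>_mem[OF v] H_mem[OF v] by blast
  have "defect v (k \<otimes>\<^bsub>W v\<^esub> g v) \<otimes>\<^bsub>W v\<^esub> shift v k (g v) = k \<otimes>\<^bsub>W v\<^esub> defect v (g v)"
  proof -
    have "inv\<^bsub>W v\<^esub> b \<otimes>\<^bsub>W v\<^esub> (b \<otimes>\<^bsub>W v\<^esub> y) = y"
      if "b \<in> carrier (W v)" "y \<in> carrier (W v)" for b y
      using that by (simp add: Wv.m_assoc[symmetric])
    then show ?thesis
      using \<sigma> H_mem[OF v k] H_mem[OF v gv] by (simp add: defect_def shift_def Wv.m_assoc)
  qed
  then have eq: "(\<lambda>u\<in>V. d' u \<otimes>\<^bsub>W u\<^esub> single v (shift v k (g v)) u) = (\<lambda>u\<in>V. single v k u \<otimes>\<^bsub>W u\<^esub> d u)"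
    using dW W_group
    by (auto simp: d_def d'_def g'_def single_def restrict_def fun_eq_iff group.is_monoid)
  have "val (act v k \<omega>) = \<iota> {v} d' \<otimes>\<^bsub>GP\<^esub> (emb v (shift v k (g v)) \<otimes>\<^bsub>GP\<^esub> a)"
    using \<omega>\<Omega> by (simp add: val_def act_def \<omega>' g'_def[symmetric] d'_def[symmetric] \<iota>d)
  also have "\<dots> = \<iota> {v} (\<lambda>u\<in>V. d' u \<otimes>\<^bsub>W u\<^esub> single v (shift v k (g v)) u) \<otimes>\<^bsub>GP\<^esub> a"
    using clique d sm shift_mem[OF v] a
    by (simp add: \<iota>_mult emb_def GP.m_assoc \<iota>_closed)
  also have "\<dots> = emb v k \<otimes>\<^bsub>GP\<^esub> (\<iota> {v} d \<otimes>\<^bsub>GP\<^esub> a)"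
    unfolding eq using clique d sm[OF k] a by (simp add: \<iota>_mult emb_def GP.m_assoc \<iota>_closed)
  also have "\<dots> = emb v k \<otimes>\<^bsub>GP\<^esub> val \<omega>"
    by (simp add: val_def \<omega>' d_def[symmetric] \<iota>d)
  finally show ?thesis .
qed

text \<open>
  Any group \<open>C\<close> that receives the \<open>W v\<close> with the commutation relations of the graph product and through
  which the actions on \<open>\<Omega>\<close> factor contains the graph product: \<open>val\<close> turns the action of \<open>\<Phi> \<gamma>\<close> into left
  multiplication by \<open>\<gamma>\<close>.
\<close>

lemma embeds_if_shift_action_lifts:
  assumes C: "group C" and A: "A \<in> hom C (BijGroup \<Omega>)"
    and \<phi>: "\<And>v. v \<in> V \<Longrightarrow> \<phi> v \<in> hom (W v) C"
    and A_\<phi>: "\<And>v k. v \<in> V \<Longrightarrow> k \<in> carrier (W v) \<Longrightarrow> A (\<phi> v k) = act v k"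
    and \<phi>_commute: "\<And>v w k l. v \<in> V \<Longrightarrow> w \<in> V \<Longrightarrow> v \<noteq> w \<Longrightarrow> k \<in> carrier (W v) \<Longrightarrow> l \<in> carrier (W w) \<Longrightarrow>
      (v, w) \<in> E \<or> k \<in> P v \<or> l \<in> P w \<Longrightarrow> \<phi> v k \<otimes>\<^bsub>C\<^esub> \<phi> w l = \<phi> w l \<otimes>\<^bsub>C\<^esub> \<phi> v k"
  shows "\<exists>\<Phi> \<in> hom GP C. \<forall>\<gamma> \<in> carrier GP. \<Phi> \<gamma> = \<one>\<^bsub>C\<^esub> \<longrightarrow> \<gamma> = \<one>\<^bsub>GP\<^esub>"
proof -
  interpret C: group C by (rule C)
  interpret B: group "BijGroup \<Omega>" by (rule group_BijGroup)
  obtain vs where vs: "distinct vs" "set vs = V" using finite_distinct_list[OF V_finite] by blast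
  have \<phi>_closed: "\<phi> v k \<in> carrier C" if "v \<in> V" "k \<in> carrier (W v)" for v k
    using hom_in_carrier[OF \<phi>[OF that(1)] that(2)] .
  \<comment> \<open>The factors commute, so the chosen order of the vertices is immaterial, and the same formula serves all cliques.\<close>
  define f where "f g = foldr (\<lambda>v a. \<phi> v (g v) \<otimes>\<^bsub>C\<^esub> a) vs \<one>\<^bsub>C\<^esub>" for g
  have local_mem: "g v \<in> H v" "g v \<in> carrier (W v)" "v \<in> S \<or> g v \<in> P v"
    if "g \<in> carrier (local_group S)" "v \<in> V" for g v S
    using that H_mem[OF that(2), of "g v"] by (auto simp: local_group_carrier PiE_iff split: if_splits)
  have f_hom: "f \<in> hom (local_group S) C" if S: "S \<in> cliques" for S
  proof (rule homI)
    show "f g \<in> carrier C" if "g \<in> carrier (local_group S)" for g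
      unfolding f_def using vs local_mem[OF that] by (intro C.foldr_mult_closed \<phi>_closed) auto
    fix g h assume g: "g \<in> carrier (local_group S)" and h: "h \<in> carrier (local_group S)"
    have "f (g \<otimes>\<^bsub>local_group S\<^esub> h) = foldr (\<lambda>v a. (\<phi> v (g v) \<otimes>\<^bsub>C\<^esub> \<phi> v (h v)) \<otimes>\<^bsub>C\<^esub> a) vs \<one>\<^bsub>C\<^esub>"
      unfolding f_def
      by (rule foldr_cong)
         (use vs local_mem[OF g] local_mem[OF h] in \<open>auto simp: local_group_mult hom_mult[OF \<phi>]\<close>)
    also have "\<dots> = f g \<otimes>\<^bsub>C\<^esub> f h"
      unfolding f_def
    proof (rule C.foldr_mult_distrib[OF vs(1)])
      fix v w assume vw: "v \<in> set vs" "w \<in> set vs" "v \<noteq> w"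
      have "(v, w) \<in> E \<or> h v \<in> P v \<or> g w \<in> P w"
        using S vw local_mem(3)[OF g, of w] local_mem(3)[OF h, of v] vs(2)
        by (auto simp: complete_subgraphs_def)
      then show "\<phi> v (h v) \<otimes>\<^bsub>C\<^esub> \<phi> w (g w) = \<phi> w (g w) \<otimes>\<^bsub>C\<^esub> \<phi> v (h v)"
        using vw vs(2) local_mem(2)[OF g] local_mem(2)[OF h] by (intro \<phi>_commute) auto
    qed (use vs local_mem(2)[OF g] local_mem(2)[OF h] \<phi>_closed in auto)
    finally show "f (g \<otimes>\<^bsub>local_group S\<^esub> h) = f g \<otimes>\<^bsub>C\<^esub> f h" .
  qed
  obtain \<Phi> where \<Phi>: "\<Phi> \<in> hom GP C"
    and \<Phi>_\<iota>: "\<And>S g. S \<in> cliques \<Longrightarrow> g \<in> carrier (local_group S) \<Longrightarrow> \<Phi> (\<iota> S g) = f g"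
    using group_colimit_universal[OF C, of cliques local_group "\<lambda>S. f" "(\<subseteq>)" "\<lambda>S T g. g"]
      f_hom group_local_group
    unfolding GP_def graph_product_of_pairs_def \<iota>_def by blast
  have A_mult: "A (c \<otimes>\<^bsub>C\<^esub> d) \<omega> = A c (A d \<omega>)" if "c \<in> carrier C" "d \<in> carrier C" "\<omega> \<in> \<Omega>" for c d \<omega>
    using that hom_in_carrier[OF A] by (simp add: hom_mult[OF A] mult_BijGroup_apply)
  have A_one: "A \<one>\<^bsub>C\<^esub> \<omega> = \<omega>" if "\<omega> \<in> \<Omega>" for \<omega>
    using that hom_one[OF A C group_BijGroup] by (simp add: BijGroup_def)
  have f_equivariant: "A (f g) \<omega> \<in> \<Omega>H \<and> val (A (f g) \<omega>) = \<iota> S g \<otimes>\<^bsub>GP\<^esub> val \<omega>"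
    if S: "S \<in> cliques" and g: "g \<in> carrier (local_group S)" and \<omega>: "\<omega> \<in> \<Omega>H" for S g \<omega>
  proof -
    have "A (foldr (\<lambda>v a. \<phi> v (g v) \<otimes>\<^bsub>C\<^esub> a) us \<one>\<^bsub>C\<^esub>) \<omega> \<in> \<Omega>H \<and>
        val (A (foldr (\<lambda>v a. \<phi> v (g v) \<otimes>\<^bsub>C\<^esub> a) us \<one>\<^bsub>C\<^esub>) \<omega>)
          = foldr (\<lambda>v a. emb v (g v) \<otimes>\<^bsub>GP\<^esub> a) us \<one>\<^bsub>GP\<^esub> \<otimes>\<^bsub>GP\<^esub> val \<omega>"
      if "set us \<subseteq> V" for us
      using that
    proof (induction us)
      case Nil
      then show ?case using \<omega> \<Omega>H_subset val_closed by (auto simp: A_one)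
    next
      case (Cons u us)
      let ?c = "foldr (\<lambda>v a. \<phi> v (g v) \<otimes>\<^bsub>C\<^esub> a) us \<one>\<^bsub>C\<^esub>"
      have u: "u \<in> V" "g u \<in> H u" "g u \<in> carrier (W u)" using Cons.prems local_mem[OF g] by auto
      have c: "?c \<in> carrier C"
        using Cons.prems local_mem[OF g] by (intro C.foldr_mult_closed \<phi>_closed) auto
      have e: "foldr (\<lambda>v a. emb v (g v) \<otimes>\<^bsub>GP\<^esub> a) us \<one>\<^bsub>GP\<^esub> \<in> carrier GP"
        using Cons.prems local_mem[OF g] by (intro GP.foldr_mult_closed emb_closed) auto
      have "A (\<phi> u (g u) \<otimes>\<^bsub>C\<^esub> ?c) \<omega> = act u (g u) (A ?c \<omega>)"
        using A_mult[OF \<phi>_closed[OF u(1,3)] c subsetD[OF \<Omega>H_subset \<omega>]] u by (simp add: A_\<phi>)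
      then show ?case
        using Cons u e \<omega> by (simp add: act_\<Omega>H val_act val_closed GP.m_assoc)
    qed
    from this[of vs] show ?thesis using vs by (simp add: f_def \<iota>_eq_prod_emb[OF S g vs])
  qed
  define \<omega>0 where "\<omega>0 = ((\<lambda>v\<in>V. \<one>\<^bsub>W v\<^esub>), \<one>\<^bsub>GP\<^esub>)"
  have \<omega>0: "\<omega>0 \<in> \<Omega>H"
    using subgroup.one_closed[OF H_subgroup] by (auto simp: \<omega>0_def \<Omega>H_def)
  have orbit: "A (\<Phi> \<gamma>) \<omega>0 \<in> \<Omega>H \<and> val (A (\<Phi> \<gamma>) \<omega>0) = \<gamma> \<otimes>\<^bsub>GP\<^esub> val \<omega>0" if "\<gamma> \<in> carrier GP" for \<gamma>
    using that
  proof (induction rule: GP_induct)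
    case one
    then show ?case
      using hom_one[OF \<Phi> GP.is_group C] \<omega>0 \<Omega>H_subset val_closed by (auto simp: A_one)
  next
    case (mult S g \<gamma>)
    have "A (\<Phi> (\<iota> S g \<otimes>\<^bsub>GP\<^esub> \<gamma>)) \<omega>0 = A (f g) (A (\<Phi> \<gamma>) \<omega>0)"
      using mult \<omega>0 \<Omega>H_subset hom_in_carrier[OF f_hom] hom_in_carrier[OF \<Phi>]
      by (auto simp: hom_mult[OF \<Phi>] \<iota>_closed \<Phi>_\<iota> intro!: A_mult)
    then show ?case
      using f_equivariant[OF mult(1,2), of "A (\<Phi> \<gamma>) \<omega>0"] mult \<iota>_closed val_closed[OF \<omega>0] by (simp add: GP.m_assoc)
  qed
  have "\<gamma> = \<one>\<^bsub>GP\<^esub>" if \<gamma>: "\<gamma> \<in> carrier GP" and "\<Phi> \<gamma> = \<one>\<^bsub>C\<^esub>" for \<gamma>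
  proof -
    have "\<gamma> \<otimes>\<^bsub>GP\<^esub> val \<omega>0 = val \<omega>0"
      using orbit[OF \<gamma>] that(2) \<omega>0 \<Omega>H_subset by (auto simp: A_one)
    then show ?thesis
      using GP.r_cancel_one[of "val \<omega>0" \<gamma>] val_closed[OF \<omega>0] \<gamma> by simp
  qed
  then show ?thesis using \<Phi> by blast
qed

end

section \<open>The ambient Coxeter group\<close>

text \<open>
  The entry \<open>2\<close> says that the two generators commute, and \<open>0\<close> stands for \<open>\<infinity>\<close>.
\<close>

definition pair_matrix ::
  "('v \<times> 'v) set \<Rightarrow> ('v \<Rightarrow> 'a set) \<Rightarrow> ('v \<Rightarrow> 'a \<Rightarrow> 'a \<Rightarrow> nat) \<Rightarrow> 'v \<times> 'a \<Rightarrow> 'v \<times> 'a \<Rightarrow> nat" where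
  "pair_matrix E T m = (\<lambda>(v, s) (w, t).
    if v = w then m v s t else if (v, w) \<in> E \<or> s \<in> T v \<or> t \<in> T w then 2 else 0)"

lemma coxeter_matrix_pair_matrix:
  assumes "simple_graph_on V E" "\<And>v. v \<in> V \<Longrightarrow> coxeter_matrix (S v) (m v)"
  shows "coxeter_matrix (Sigma V S) (pair_matrix E T m)"
proof -
  have "(v, w) \<in> E \<longleftrightarrow> (w, v) \<in> E" for v w
    using assms(1) by (auto simp: simple_graph_on_def dest: symD)
  then show ?thesis
    using assms(2) unfolding coxeter_matrix_def pair_matrix_def by (auto split: if_splits)
qed

theorem corollary5p19:
  fixes V :: "'v set" and E :: "('v \<times> 'v) set"
    and W :: "'v \<Rightarrow> 'a monoid" and S P H :: "'v \<Rightarrow> 'a set"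
  assumes "finite V" and "simple_graph_on V E"
    and "\<And>v. v \<in> V \<Longrightarrow> coxeter_system (W v) (S v)"
    and "\<And>v. v \<in> V \<Longrightarrow> parabolic_subgroup (W v) (S v) (P v)"
    and "\<And>v. v \<in> V \<Longrightarrow> subgroup (H v) (W v)"
  shows "linear_group
    (graph_product_of_pairs V E (\<lambda>v. (W v)\<lparr>carrier := H v\<rparr>) (\<lambda>v. H v \<inter> P v))"
proof -
  have "\<exists>m. \<forall>v\<in>V. has_coxeter_presentation (W v) (S v) (m v)"
    using assms(3) by (intro bchoice) (auto simp: coxeter_system_def has_coxeter_presentation_def)
  then obtain m where m: "\<And>v. v \<in> V \<Longrightarrow> has_coxeter_presentation (W v) (S v) (m v)" by blast
  have "\<exists>T. \<forall>v\<in>V. T v \<subseteq> S v \<and> P v = generate (W v) (T v)"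
    using assms(4) by (intro bchoice) (auto simp: parabolic_subgroup_def)
  then obtain T where T: "\<And>v. v \<in> V \<Longrightarrow> T v \<subseteq> S v" "\<And>v. v \<in> V \<Longrightarrow> P v = generate (W v) (T v)"
    by blast
  have W: "group (W v)" and S: "S v \<subseteq> carrier (W v)" "finite (S v)" if "v \<in> V" for v
    using assms(3)[OF that] by (auto simp: coxeter_system_def)
  have P: "subgroup (P v) (W v)" if "v \<in> V" for v
    using T[OF that] S[OF that] by (auto intro: group.generate_is_subgroup[OF W[OF that]])
  interpret subgroup_pairs V E W P H
    using assms(1,2,5) W P by (intro subgroup_pairs.intro) auto
  define X where "X = Sigma V S"
  have X_mem: "(v, s) \<in> X" if "v \<in> V" "s \<in> S v" for v s
    using that by (simp add: X_def)
  define M where "M = pair_matrix E T m"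
  have M: "coxeter_matrix X M"
    unfolding X_def M_def
    using assms(2) m by (intro coxeter_matrix_pair_matrix) (auto simp: has_coxeter_presentation_def)
  interpret cox: coxeter_data X M
    using assms(1) S(2) M by unfold_locales (auto simp: X_def)
  interpret B: group "BijGroup \<Omega>" by (rule group_BijGroup)
  have act_closed: "act v k \<in> carrier (BijGroup \<Omega>)" if "v \<in> V" "k \<in> carrier (W v)" for v k
    using hom_in_carrier[OF act_hom] that .
  have square: "s \<otimes>\<^bsub>W v\<^esub> s = \<one>\<^bsub>W v\<^esub>" if v: "v \<in> V" and s: "s \<in> S v" for v s
  proof -
    interpret Wv: group "W v" using W[OF v] .
    have "m v s s = 1" using m[OF v] s by (auto simp: has_coxeter_presentation_def coxeter_matrix_def)
    then show ?thesis
      using coxeter_presentation_order[OF m[OF v] s s] s S(1)[OF v] by (simp add: subset_iff)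
  qed
  have "\<exists>A \<in> hom cox.C (BijGroup \<Omega>). \<forall>x\<in>X. A (cox.gen x) = act (fst x) (snd x)"
    unfolding cox.C_def cox.gen_def
  proof (rule B.coxeter_hom_exists)
    show "(\<lambda>x. act (fst x) (snd x)) \<in> X \<rightarrow> carrier (BijGroup \<Omega>)"
      using act_closed subsetD[OF S(1)] by (auto simp: X_def)
    fix x y assume "x \<in> X" "y \<in> X"
    then obtain v s w t where x: "x = (v, s)" "v \<in> V" "s \<in> S v" and y: "y = (w, t)" "w \<in> V" "t \<in> S w"
      by (auto simp: X_def)
    have st: "s \<in> carrier (W v)" "t \<in> carrier (W w)" using S(1) x y by auto
    note closed = act_closed[OF x(2) st(1)] act_closed[OF y(2) st(2)]
    show "(act (fst x) (snd x) \<otimes>\<^bsub>BijGroup \<Omega>\<^esub> act (fst y) (snd y)) [^]\<^bsub>BijGroup \<Omega>\<^esub> M x y = \<one>\<^bsub>BijGroup \<Omega>\<^esub>"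
    proof (cases "v = w")
      case True
      interpret act: group_hom "W v" "BijGroup \<Omega>" "act v"
        using W[OF x(2)] act_hom[OF x(2)]
        by (simp add: group_hom_def group_hom_axioms_def group_BijGroup)
      have "act v ((s \<otimes>\<^bsub>W v\<^esub> t) [^]\<^bsub>W v\<^esub> m v s t) = \<one>\<^bsub>BijGroup \<Omega>\<^esub>"
        using coxeter_presentation_order[OF m[OF x(2)] x(3), of t] y(3) by (simp add: True[symmetric])
      then show ?thesis
        using st by (simp add: x(1) y(1) True[symmetric] act.hom_nat_pow M_def pair_matrix_def)
    next
      case False
      show ?thesis
      proof (cases "(v, w) \<in> E \<or> s \<in> T v \<or> t \<in> T w")
        case adm: True
        have "s \<in> P v" if "s \<in> T v" using that T(2)[OF x(2)] by (simp add: generate.incl)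
        moreover have "t \<in> P w" if "t \<in> T w" using that T(2)[OF y(2)] by (simp add: generate.incl)
        ultimately have comm: "act v s \<otimes>\<^bsub>BijGroup \<Omega>\<^esub> act w t = act w t \<otimes>\<^bsub>BijGroup \<Omega>\<^esub> act v s"
          using adm x y st False by (intro act_commute) auto
        have sq: "act v s \<otimes>\<^bsub>BijGroup \<Omega>\<^esub> act v s = \<one>\<^bsub>BijGroup \<Omega>\<^esub>"
            "act w t \<otimes>\<^bsub>BijGroup \<Omega>\<^esub> act w t = \<one>\<^bsub>BijGroup \<Omega>\<^esub>"
          using hom_mult[OF act_hom[OF x(2)] st(1) st(1)] hom_mult[OF act_hom[OF y(2)] st(2) st(2)]
            square[OF x(2,3)] square[OF y(2,3)]
            hom_one[OF act_hom[OF x(2)] W[OF x(2)] group_BijGroup]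
            hom_one[OF act_hom[OF y(2)] W[OF y(2)] group_BijGroup]
          by simp_all
        have "(act v s \<otimes>\<^bsub>BijGroup \<Omega>\<^esub> act w t) [^]\<^bsub>BijGroup \<Omega>\<^esub> (2::nat) = \<one>\<^bsub>BijGroup \<Omega>\<^esub>"
          using B.pow_mult_distrib[OF comm closed, of 2] closed by (simp add: numeral_2_eq_2 sq)
        then show ?thesis using x y False adm by (simp add: M_def pair_matrix_def)
      next
        case False
        with \<open>v \<noteq> w\<close> show ?thesis using x y by (simp add: M_def pair_matrix_def)
      qed
    qed
  qed
  then obtain A where A: "A \<in> hom cox.C (BijGroup \<Omega>)"
    and A_gen: "\<And>v s. v \<in> V \<Longrightarrow> s \<in> S v \<Longrightarrow> A (cox.gen (v, s)) = act v s"
    by (auto simp: X_def)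
  have "\<exists>\<phi>. \<forall>v\<in>V. \<phi> v \<in> hom (W v) cox.C \<and> (\<forall>s\<in>S v. \<phi> v s = cox.gen (v, s))"
  proof (rule bchoice, rule ballI)
    fix v assume v: "v \<in> V"
    have rel: "(cox.gen (v, s) \<otimes>\<^bsub>cox.C\<^esub> cox.gen (v, t)) [^]\<^bsub>cox.C\<^esub> m v s t = \<one>\<^bsub>cox.C\<^esub>"
      if "s \<in> S v" "t \<in> S v" for s t
      using cox.gen_order[of "(v, s)" "(v, t)"] v that by (simp add: X_def M_def pair_matrix_def)
    have gens: "(\<lambda>s. cox.gen (v, s)) \<in> S v \<rightarrow> carrier cox.C"
      using v by (simp add: X_mem)
    show "\<exists>F. F \<in> hom (W v) cox.C \<and> (\<forall>s\<in>S v. F s = cox.gen (v, s))"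
      using coxeter_presentation_hom_exists[OF m[OF v] cox.C.is_group gens rel] unfolding Bex_def .
  qed
  then obtain \<phi> where \<phi>: "\<And>v. v \<in> V \<Longrightarrow> \<phi> v \<in> hom (W v) cox.C"
    and \<phi>_gen: "\<And>v s. v \<in> V \<Longrightarrow> s \<in> S v \<Longrightarrow> \<phi> v s = cox.gen (v, s)"
    by blast
  have A_\<phi>: "A (\<phi> v k) = act v k" if v: "v \<in> V" and k: "k \<in> carrier (W v)" for v k
  proof -
    have "(A \<circ> \<phi> v) k = act v k"
      using hom_compose[OF \<phi>[OF v] A] act_hom[OF v] S(1)[OF v]
    proof (rule hom_eq_on_generate[OF W[OF v] group_BijGroup])
      show "k \<in> generate (W v) (S v)" using k coxeter_presentation_generate[OF m[OF v]] by simp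
    qed (use v in \<open>simp add: \<phi>_gen A_gen\<close>)
    then show ?thesis by simp
  qed
  \<comment> \<open>With \<open>K = T v\<close> or \<open>L = T w\<close> this covers the parabolic subgroups, with \<open>K = S v\<close> and \<open>L = S w\<close> the whole groups.\<close>
  have commute: "\<phi> v k \<otimes>\<^bsub>cox.C\<^esub> \<phi> w l = \<phi> w l \<otimes>\<^bsub>cox.C\<^esub> \<phi> v k"
    if v: "v \<in> V" and w: "w \<in> V" and "v \<noteq> w" and k: "k \<in> generate (W v) K" and l: "l \<in> generate (W w) L"
      and K: "K \<subseteq> S v" and L: "L \<subseteq> S w" and adm: "(v, w) \<in> E \<or> K \<subseteq> T v \<or> L \<subseteq> T w" for v w k l K L
  proof -
    have gens: "\<phi> w t \<otimes>\<^bsub>cox.C\<^esub> \<phi> v s = \<phi> v s \<otimes>\<^bsub>cox.C\<^esub> \<phi> w t" if s: "s \<in> K" and t: "t \<in> L" for s t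
    proof -
      have mem: "(v, s) \<in> X" "(w, t) \<in> X" using v w s t K L by (auto simp: X_def)
      define a b where "a = cox.gen (v, s)" and "b = cox.gen (w, t)"
      have ab: "a \<in> carrier cox.C" "b \<in> carrier cox.C" "inv\<^bsub>cox.C\<^esub> a = a" "inv\<^bsub>cox.C\<^esub> b = b"
        using mem by (auto simp: a_def b_def cox.inv_gen)
      have "M (v, s) (w, t) = 2" using adm s t \<open>v \<noteq> w\<close> by (auto simp: M_def pair_matrix_def)
      then have "(a \<otimes>\<^bsub>cox.C\<^esub> b) \<otimes>\<^bsub>cox.C\<^esub> (a \<otimes>\<^bsub>cox.C\<^esub> b) = \<one>\<^bsub>cox.C\<^esub>"
        using cox.gen_order[OF mem] ab by (simp add: numeral_2_eq_2 a_def b_def)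
      then have "a \<otimes>\<^bsub>cox.C\<^esub> b = inv\<^bsub>cox.C\<^esub> (a \<otimes>\<^bsub>cox.C\<^esub> b)"
        using ab by (metis cox.C.inv_equality cox.C.m_closed)
      then have "a \<otimes>\<^bsub>cox.C\<^esub> b = b \<otimes>\<^bsub>cox.C\<^esub> a" using ab by (simp add: cox.C.inv_mult_group)
      moreover have "\<phi> v s = a" "\<phi> w t = b"
        using \<phi>_gen v w s t K L by (auto simp: a_def b_def)
      ultimately show ?thesis by simp
    qed
    have KW: "K \<subseteq> carrier (W v)" and LW: "L \<subseteq> carrier (W w)" using S(1) v w K L by blast+
    have "\<phi> w t \<otimes>\<^bsub>cox.C\<^esub> \<phi> v k = \<phi> v k \<otimes>\<^bsub>cox.C\<^esub> \<phi> w t" if "t \<in> L" for t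
      by (rule commute_on_generate[OF W[OF v] cox.C.is_group \<phi>[OF v] _ KW _ k])
         (use gens that LW hom_in_carrier[OF \<phi>[OF w]] in auto)
    then show ?thesis
      by (intro commute_on_generate[OF W[OF w] cox.C.is_group \<phi>[OF w] _ LW _ l])
         (use group.generate_in_carrier[OF W[OF v] KW k] hom_in_carrier[OF \<phi>[OF v]] in auto)
  qed
  have "\<exists>\<Phi> \<in> hom GP cox.C. \<forall>\<gamma> \<in> carrier GP. \<Phi> \<gamma> = \<one>\<^bsub>cox.C\<^esub> \<longrightarrow> \<gamma> = \<one>\<^bsub>GP\<^esub>"
  proof (rule embeds_if_shift_action_lifts[OF cox.C.is_group A \<phi> A_\<phi>])
    fix v w k l
    assume vw: "v \<in> V" "w \<in> V" "v \<noteq> w" and kl: "k \<in> carrier (W v)" "l \<in> carrier (W w)"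
      and adm: "(v, w) \<in> E \<or> k \<in> P v \<or> l \<in> P w"
    have gen: "k \<in> generate (W v) (S v)" "l \<in> generate (W w) (S w)"
      using kl coxeter_presentation_generate m vw by blast+
    from adm show "\<phi> v k \<otimes>\<^bsub>cox.C\<^esub> \<phi> w l = \<phi> w l \<otimes>\<^bsub>cox.C\<^esub> \<phi> v k"
      using commute[OF vw, of k "S v" l "S w"] commute[OF vw, of k "T v" l "S w"]
        commute[OF vw, of k "S v" l "T w"] gen T vw by auto
  qed
  then obtain \<Phi> where "\<Phi> \<in> hom GP cox.C" "\<And>\<gamma>. \<gamma> \<in> carrier GP \<Longrightarrow> \<Phi> \<gamma> = \<one>\<^bsub>cox.C\<^esub> \<Longrightarrow> \<gamma> = \<one>\<^bsub>GP\<^esub>"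
    by blast
  then have "linear_group GP"
    unfolding cox.C_def
    by (rule linear_group_if_embeds_in_coxeter_group[OF GP.is_group cox.X_finite M])
  then show ?thesis by (simp add: GP_def)
qed

end
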